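(* Let $w(x)$ be a weight function on the interval $-1\le x\le 1$ such that $w(\cos\theta)|\sin\theta|=f(\theta)$ belongs to the Szegő weight class $G$, and let $\{p_j\}_{j\ge0}$ be the orthogonal polynomials associated to $w(x)$. For the random orthogonal polynomials $P_n(z)=\sum_{j=0}^n\eta_jp_j(z)$, where $\eta_j=\alpha_j+i\beta_j$ and the $\alpha_j,\beta_j$ are all independent real standard normal random variables, the intensity function $h_n^P$ satisfies $$\lim_{n\to\infty}h_n^P(z)=\frac{1}{4\pi\left(\operatorname{Im}(z)\right)^2}\left(1-\frac{\left(\operatorname{Im}(z)\right)^2\left|z+\sqrt{z^2-1}\right|^2}{|z^2-1|\left(\operatorname{Im}\left(z+\sqrt{z^2-1}\right)\right)^2}\right)$$ for all $z\in\mathbb{C}\setminus[-1,1]$, where at real $z$ the right-hand side is understood as its continuous extension. Furthermore, the convergence holds uniformly on compact subsets of $\mathbb{C}\setminus[-1,1]$.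
   Context: A function $f(\theta)\ge 0$ belongs to the Szegő weight class $G$ if $f$ is defined and measurable on $[-\pi,\pi]$ and the integrals $\int_{-\pi}^{\pi}f(\theta)\,d\theta$ and $\int_{-\pi}^{\pi}|\log f(\theta)|\,d\theta$ exist (are finite), with the first integral positive. The orthogonal polynomials associated to $w$ are polynomials $p_j$, $j\ge 0$, of exact degree $j$ with real coefficients such that $\int_{-1}^1 p_k(x)p_m(x)w(x)\,dx=\delta_{km}$ for all $k,m\in\mathbb{N}\cup\{0\}$. The intensity function (density of the expected number of zeros of $P_n$) is $$h_n^P(z)=\frac{K_n^{(1,1)}(z,z)\,K_n(z,z)-\left|K_n^{(0,1)}(z,z)\right|^2}{\pi\left(K_n(z,z)\right)^2},$$ where $$K_n(z,w)=\sum_{j=0}^n p_j(z)\overline{p_j(w)},\qquad K_n^{(0,1)}(z,w)=\sum_{j=0}^n p_j(z)\overline{p_j'(w)},\qquad K_n^{(1,1)}(z,w)=\sum_{j=0}^n p_j'(z)\overline{p_j'(w)}.$$ The branch of $\sqrt{z^2-1}$ on $\mathbb{C}\setminus[-1,1]$ is the one for which $|z+\sqrt{z^2-1}|>1$; that is, $\xi=z+\sqrt{z^2-1}$ is the solution of $z=\frac12(\xi+\xi^{-1})$ with $|\xi|>1$. *)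

theory Defs
  imports "HOL-Probability.Probability" "HOL-Computational_Algebra.Polynomial"
begin

definition weight_function :: "(real \<Rightarrow> real) \<Rightarrow> bool" where
  "weight_function w \<longleftrightarrow>
     set_borel_measurable lebesgue {-1..1} w \<and> (\<forall>x\<in>{-1..1}. 0 \<le> w x)"

(* In HOL, ln 0 = 0, so integrability of \<bar>ln f\<bar> does not by itself rule out that f vanishes
   on a set of positive measure; almost everywhere positivity has to be required separately. *)
definition szego_class :: "(real \<Rightarrow> real) \<Rightarrow> bool" where
  "szego_class f \<longleftrightarrow>
     set_borel_measurable lebesgue {-pi..pi} f \<and>
     (\<forall>\<theta>\<in>{-pi..pi}. 0 \<le> f \<theta>) \<and>
     set_integrable lebesgue {-pi..pi} f \<and>
     (AE \<theta> in lebesgue. \<theta> \<in> {-pi..pi} \<longrightarrow> 0 < f \<theta>) \<and>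
     set_integrable lebesgue {-pi..pi} (\<lambda>\<theta>. \<bar>ln (f \<theta>)\<bar>) \<and>
     0 < (LINT \<theta>:{-pi..pi}|lebesgue. f \<theta>)"

(* degree 0 = 0, but p 0 is nonzero by normalization, so every p j has exact degree j. *)
definition orthonormal_polys :: "(real \<Rightarrow> real) \<Rightarrow> (nat \<Rightarrow> real poly) \<Rightarrow> bool" where
  "orthonormal_polys w p \<longleftrightarrow>
     (\<forall>j. degree (p j) = j) \<and>
     (\<forall>k m. set_integrable lebesgue {-1..1} (\<lambda>x. poly (p k) x * poly (p m) x * w x) \<and>
            (LINT x:{-1..1}|lebesgue. poly (p k) x * poly (p m) x * w x) = (if k = m then 1 else 0))"

definition cpoly :: "real poly \<Rightarrow> complex \<Rightarrow> complex" where
  "cpoly q z = poly (map_poly complex_of_real q) z"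

definition kernel :: "(nat \<Rightarrow> real poly) \<Rightarrow> nat \<Rightarrow> complex \<Rightarrow> complex \<Rightarrow> complex" where
  "kernel p n z w = (\<Sum>j\<le>n. cpoly (p j) z * cnj (cpoly (p j) w))"

definition kernel01 :: "(nat \<Rightarrow> real poly) \<Rightarrow> nat \<Rightarrow> complex \<Rightarrow> complex \<Rightarrow> complex" where
  "kernel01 p n z w = (\<Sum>j\<le>n. cpoly (p j) z * cnj (cpoly (pderiv (p j)) w))"

definition kernel11 :: "(nat \<Rightarrow> real poly) \<Rightarrow> nat \<Rightarrow> complex \<Rightarrow> complex \<Rightarrow> complex" where
  "kernel11 p n z w = (\<Sum>j\<le>n. cpoly (pderiv (p j)) z * cnj (cpoly (pderiv (p j)) w))"

lemma kernel_diag_real: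
  "kernel p n z z = complex_of_real (Re (kernel p n z z))"
  "kernel11 p n z z = complex_of_real (Re (kernel11 p n z z))"
  by (simp_all add: kernel_def kernel11_def complex_eq_iff)

(* The closed form of the density of the expected number of zeros of P_n = sum_{j<=n} eta_j p_j
   for i.i.d. complex Gaussian eta_j; it depends on the basis p and on n only.
   Re only converts the real diagonal values of the kernels to type real
   (lemma kernel_diag_real). *)
definition intensity :: "(nat \<Rightarrow> real poly) \<Rightarrow> nat \<Rightarrow> complex \<Rightarrow> real" where
  "intensity p n z =
     (Re (kernel11 p n z z) * Re (kernel p n z z) - (cmod (kernel01 p n z z))\<^sup>2) /
     (pi * (Re (kernel p n z z))\<^sup>2)"

(* The branch of sqrt (z^2 - 1) off [-1, 1] with cmod (z + sqrt (z^2 - 1)) > 1;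
   csqrt (z^2 - 1) would select a different branch for Re z < 0. *)
definition sqrt_branch :: "complex \<Rightarrow> complex" where
  "sqrt_branch z = (THE s. s\<^sup>2 = z\<^sup>2 - 1 \<and> cmod (z + s) > 1)"

lemma sqrt_branch_ex1:
  assumes "z \<notin> closed_segment (-1) 1"
  shows "\<exists>!s. s\<^sup>2 = z\<^sup>2 - 1 \<and> cmod (z + s) > 1"
proof -
  define t where "t = csqrt (z\<^sup>2 - 1)"
  have t2: "t\<^sup>2 = z\<^sup>2 - 1" by (simp add: t_def)
  have prod1: "(z + t) * (z - t) = 1"
    using t2 by (simp add: algebra_simps power2_eq_square)
  hence nprod: "cmod (z + t) * cmod (z - t) = 1"
    by (metis norm_mult norm_one)
  have ne1: "cmod (z + t) \<noteq> 1"
  proof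
    assume u: "cmod (z + t) = 1"
    have "z - t = cnj (z + t)"
    proof -
      have "(z + t) * cnj (z + t) = 1" using complex_norm_square [of "z + t"] u by simp
      moreover have "z + t \<noteq> 0" using u by auto
      ultimately show ?thesis using prod1 by (metis mult_left_cancel)
    qed
    hence "2 * z = (z + t) + cnj (z + t)" by (simp add: algebra_simps)
    also have "\<dots> = complex_of_real (2 * Re (z + t))" by (rule complex_add_cnj)
    finally have z: "z = complex_of_real (Re (z + t))" by (simp add: complex_eq_iff)
    have "\<bar>Re (z + t)\<bar> \<le> 1" using u abs_Re_le_cmod by metis
    hence "Re (z + t) \<in> closed_segment (-1) 1" by (auto simp: closed_segment_eq_real_ivl)
    hence "complex_of_real (Re (z + t)) \<in> closed_segment (-1) 1"
      using of_real_closed_segment [of "Re (z + t)" "-1" 1, where 'a = complex] by simp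
    hence "z \<in> closed_segment (-1) 1" using z by simp
    with assms show False by simp
  qed
  have roots: "s = t \<or> s = - t" if "s\<^sup>2 = z\<^sup>2 - 1" for s
    using that t2 power2_eq_iff by metis
  show ?thesis
  proof (cases "cmod (z + t) > 1")
    case True
    hence "cmod (z - t) < 1" using nprod
      by (smt (verit) mult_less_cancel_right1 norm_ge_zero mult_cancel_left1)
    thus ?thesis using True roots t2 by (intro ex1I [of _ t]) fastforce+
  next
    case False
    hence lt: "cmod (z + t) < 1" using ne1 by simp
    have "cmod (z - t) > 1"
    proof (rule ccontr)
      assume "\<not> ?thesis"
      hence "cmod (z + t) * cmod (z - t) \<le> cmod (z + t) * 1" by (intro mult_left_mono) auto
      thus False using nprod lt by simp
    qed
    thus ?thesis using False roots t2 by (intro ex1I [of _ "- t"]) fastforce+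
  qed
qed

definition limit_formula :: "complex \<Rightarrow> real" where
  "limit_formula z =
     1 / (4 * pi * (Im z)\<^sup>2) *
     (1 - (Im z)\<^sup>2 * (cmod (z + sqrt_branch z))\<^sup>2 /
          (cmod (z\<^sup>2 - 1) * (Im (z + sqrt_branch z))\<^sup>2))"

(* limit_formula divides by zero on the real line; there it is replaced by its limit
   from nonreal points. *)
definition limit_intensity :: "complex \<Rightarrow> real" where
  "limit_intensity z =
     (if Im z \<noteq> 0 then limit_formula z
      else Lim (at z within {u. Im u \<noteq> 0}) limit_formula)"

end

theory Submission
  imports Defs "HOL-Complex_Analysis.Complex_Analysis"
begin

text \<open>Write \<open>K\<close> for the diagonal kernel \<open>\<Sum>j\<le>n. \<bar>p\<^sub>j(z)\<bar>\<^sup>2\<close>. The intensity is \<open>1/\<pi>\<close> times the mixed derivative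
\<open>\<partial>\<^sub>z \<partial>\<^sub>z\<^sub>* ln K\<close>, where \<open>z*\<close> is the conjugate variable, so the factor \<open>\<bar>p\<^sub>n(z)\<bar>\<^sup>2\<close> can be
divided out of \<open>K\<close>: only the quotients \<open>s\<^sub>j = p\<^sub>j / p\<^sub>n\<close> and their derivatives matter, and the
intensity becomes a Gram determinant in them (\<open>intensity_eq_gram\<close>). Passing from \<open>n\<close> to \<open>n + 1\<close>
multiplies every \<open>s\<^sub>j\<close> by \<open>g\<^sub>n = p\<^sub>n / p\<^sub>n\<^sub>+\<^sub>1\<close> and appends the constant \<open>1\<close>, so the entries of the Gram
matrix satisfy affine recursions with multiplier \<open>\<bar>g\<^sub>n\<bar>\<^sup>2\<close>. If \<open>g\<^sub>n\<close> tends to \<open>\<zeta>\<close> locally uniformly and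
\<open>\<bar>\<zeta>\<bar> < 1\<close>, these recursions contract, and the intensity tends to \<open>\<bar>\<zeta>'\<bar>\<^sup>2 / (\<pi> (1 - \<bar>\<zeta>\<bar>\<^sup>2)\<^sup>2)\<close>
(\<open>intensity_limit_of_ratio\<close>). Thus only the asymptotics of the ratios of
consecutive \<open>p\<^sub>n\<close> are needed.

Here \<open>\<zeta>(z) = z - \<surd>(z\<^sup>2 - 1)\<close>, which maps the complement of \<open>[-1, 1]\<close> into the unit disk and inverts
\<open>\<zeta> \<mapsto> (\<zeta> + 1/\<zeta>)/2\<close>. The limit density is continuous on the whole complement, real points included;
at nonreal points it agrees with the asserted formula (\<open>limit_formula_eq\<close>), hence it is the
continuous extension of that formula.

For the ratios, put \<open>x = cos t\<close>. The weight becomes \<open>f\<close> on \<open>[0, \<pi>]\<close>, the half of an even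
weight on the unit circle. Its monic orthogonal polynomials \<open>\<Phi>\<^sub>n\<close> and their reversals \<open>\<Psi>\<^sub>n\<close> obey the
Szego recursion with real coefficients \<open>a\<^sub>n\<close> of modulus less than \<open>1\<close>, and the squared norm of \<open>\<Phi>\<^sub>n\<close>
is multiplied by \<open>1 - a\<^sub>n\<^sup>2\<close> in each step. Integrability of \<open>ln f\<close> keeps the squared norms away from
\<open>0\<close>: since \<open>\<Psi>\<^sub>n\<close> has no zeros in the closed disk and \<open>\<Psi>\<^sub>n(0) = 1\<close>, the function \<open>ln \<bar>\<Psi>\<^sub>n\<bar>\<close> has mean \<open>0\<close>,
and the inequality between the arithmetic and the geometric mean bounds the integral of
\<open>\<bar>\<Psi>\<^sub>n\<bar>\<^sup>2 f\<close> from below by a multiple of the geometric mean of \<open>f\<close> (\<open>Szego_lower_bound\<close>). Therefore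
\<open>a\<^sub>n\<close> tends to \<open>0\<close>. This forces \<open>\<Phi>\<^sub>n / \<Psi>\<^sub>n \<rightarrow> 0\<close> and \<open>\<Psi>\<^sub>n / \<Psi>\<^sub>n\<^sub>+\<^sub>1 \<rightarrow> 1\<close> uniformly on smaller disks. Up to
sign, \<open>p\<^sub>n((\<zeta> + 1/\<zeta>)/2)\<close> is the normalization of \<open>\<zeta>\<^sup>-\<^sup>n (\<Phi>\<^sub>2\<^sub>n + \<Psi>\<^sub>2\<^sub>n)(\<zeta>)\<close> (\<open>orthonormal_poly_eq_szego_poly\<close>),
so \<open>p\<^sub>n / p\<^sub>n\<^sub>+\<^sub>1\<close> tends to \<open>\<zeta>\<close> up to signs, to which the intensity is blind.\<close>

section \<open>Uniform limits: affine recursions and derivatives\<close>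

text \<open>The limit is the fixed point of the limiting affine map \<open>u \<mapsto> \<tau> u + \<nu>\<close>. The distance to it is multiplied
by at most some \<open>q < 1\<close> in each late step, up to an error that becomes small uniformly on \<open>K\<close>.\<close>
lemma uniform_limit_affine_recursion:
  fixes U t v :: "nat \<Rightarrow> 'a \<Rightarrow> complex"
  assumes rec: "\<And>n x. x \<in> K \<Longrightarrow> U (Suc n) x = t n x * U n x + v n x"
    and t: "uniform_limit K t \<tau> sequentially"
    and v: "uniform_limit K v \<nu> sequentially"
    and U: "\<And>n. bounded (U n ` K)"
    and tau: "\<And>x. x \<in> K \<Longrightarrow> cmod (\<tau> x) \<le> \<rho>" "\<rho> < 1"
    and nu: "bounded (\<nu> ` K)"
  shows "uniform_limit K U (\<lambda>x. \<nu> x / (1 - \<tau> x)) sequentially"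
proof (cases "K = {}")
  case False
  define l where "l = (\<lambda>x. \<nu> x / (1 - \<tau> x))"
  obtain C where C: "\<And>x. x \<in> K \<Longrightarrow> cmod (\<nu> x) \<le> C" using nu by (auto simp: bounded_iff)
  obtain x0 where "x0 \<in> K" using False by auto
  have rho0: "\<rho> \<ge> 0" using tau(1)[OF \<open>x0 \<in> K\<close>] by (meson norm_ge_zero order_trans)
  have C0: "C \<ge> 0" using C[OF \<open>x0 \<in> K\<close>] by (meson norm_ge_zero order_trans)
  define M where "M = C / (1 - \<rho>)"
  have M0: "M \<ge> 0" using C0 tau(2) by (simp add: M_def)
  have nz: "1 - \<tau> x \<noteq> 0" if "x \<in> K" for x using tau(1)[OF that] tau(2) by auto
  have M: "cmod (l x) \<le> M" if "x \<in> K" for x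
  proof -
    have "1 - \<rho> \<le> cmod (1 - \<tau> x)"
      using tau(1)[OF that] norm_triangle_ineq2[of 1 "\<tau> x"] by simp
    thus ?thesis unfolding l_def M_def norm_divide
      using C[OF that] tau(2) C0 by (intro frac_le) auto
  qed
  have fixpt: "l x = \<tau> x * l x + \<nu> x" if "x \<in> K" for x
    using nz[OF that] by (simp add: l_def field_simps)
  show ?thesis unfolding l_def[symmetric]
  proof (rule uniform_limitI)
    fix e :: real assume e: "e > 0"
    \<comment> \<open>A rate strictly between \<open>\<rho>\<close> and \<open>1\<close> leaves room for the deviation of \<open>t n\<close> from \<open>\<tau>\<close>.\<close>
    define q where "q = (1 + \<rho>) / 2"
    have q: "0 < q" "q < 1" using rho0 tau(2) by (auto simp: q_def)
    \<comment> \<open>An error \<open>\<eta>\<close> in each step accumulates to at most \<open>\<eta> / (1 - q) = e / 2\<close>.\<close>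
    define \<eta> where "\<eta> = e * (1 - q) / 2"
    have eta: "\<eta> > 0" using e q by (simp add: \<eta>_def)
    define \<eta>1 where "\<eta>1 = min (\<eta> / (M + 1)) (q - \<rho>)"
    have eta1: "\<eta>1 > 0" using eta M0 tau(2) by (auto simp: \<eta>1_def q_def)
    have "eventually (\<lambda>n. (\<forall>x\<in>K. dist (t n x) (\<tau> x) < \<eta>1) \<and> (\<forall>x\<in>K. dist (v n x) (\<nu> x) < \<eta>1)) sequentially"
      using uniform_limitD[OF t eta1] uniform_limitD[OF v eta1] by (rule eventually_conj)
    then obtain n0 where n0: "\<And>n x. n \<ge> n0 \<Longrightarrow> x \<in> K \<Longrightarrow> cmod (t n x - \<tau> x) < \<eta>1"
      "\<And>n x. n \<ge> n0 \<Longrightarrow> x \<in> K \<Longrightarrow> cmod (v n x - \<nu> x) < \<eta>1"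
      by (auto simp: eventually_sequentially dist_norm)
    define E where "E = (\<lambda>n x. cmod (U n x - l x))"
    have step: "E (Suc n) x \<le> q * E n x + \<eta>" if n: "n \<ge> n0" and x: "x \<in> K" for n x
    proof -
      have eq: "U (Suc n) x - l x = t n x * (U n x - l x) + ((t n x - \<tau> x) * l x + (v n x - \<nu> x))"
        using rec[OF x, of n] fixpt[OF x] by (simp add: algebra_simps)
      have "cmod (t n x) \<le> cmod (\<tau> x) + cmod (t n x - \<tau> x)" by (rule norm_triangle_sub)
      also have "\<dots> \<le> q" using tau(1)[OF x] n0(1)[OF n x] by (simp add: \<eta>1_def)
      finally have tq: "cmod (t n x) \<le> q" .
      have "cmod ((t n x - \<tau> x) * l x + (v n x - \<nu> x)) \<le> \<eta>1 * M + \<eta>1"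
        using n0[OF n x] M[OF x] M0 eta1
        by (intro order_trans[OF norm_triangle_ineq] add_mono) (auto simp: norm_mult intro!: mult_mono)
      also have "\<dots> = \<eta>1 * (M + 1)" by (simp add: algebra_simps)
      also have "\<dots> \<le> (\<eta> / (M + 1)) * (M + 1)" using M0 by (intro mult_right_mono) (auto simp: \<eta>1_def)
      also have "\<dots> = \<eta>" using M0 by simp
      finally have "cmod ((t n x - \<tau> x) * l x + (v n x - \<nu> x)) \<le> \<eta>" .
      moreover have "cmod (t n x * (U n x - l x)) \<le> q * E n x"
        using tq by (simp add: norm_mult E_def mult_right_mono)
      ultimately show ?thesis unfolding E_def[of] eq
        by (metis (no_types, lifting) E_def add_mono norm_triangle_ineq order_trans)
    qed
    have "bounded ((\<lambda>x. U n0 x - l x) ` K)"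
    proof -
      obtain D where "\<And>x. x \<in> K \<Longrightarrow> cmod (U n0 x) \<le> D" using U[of n0] by (auto simp: bounded_iff)
      hence "cmod (U n0 x - l x) \<le> D + M" if "x \<in> K" for x
        using M[OF that] that norm_triangle_ineq4[of "U n0 x" "l x"] by fastforce
      thus ?thesis by (auto simp: bounded_iff)
    qed
    then obtain D where D: "\<And>x. x \<in> K \<Longrightarrow> E n0 x \<le> D" by (auto simp: bounded_iff E_def)
    have main: "E (n0 + k) x \<le> q ^ k * D + e / 2" if x: "x \<in> K" for k x
    proof (induction k)
      case 0 thus ?case using D[OF x] e by simp
    next
      case (Suc k)
      have "E (n0 + Suc k) x \<le> q * E (n0 + k) x + \<eta>" using step[OF _ x, of "n0 + k"] by simp
      also have "\<dots> \<le> q * (q ^ k * D + e / 2) + \<eta>" using Suc q by simp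
      also have "\<dots> = q ^ Suc k * D + e / 2" by (simp add: \<eta>_def field_simps)
      finally show ?case .
    qed
    have "(\<lambda>k. q ^ k * D) \<longlonglongrightarrow> 0" using q by (intro tendsto_mult_left_zero LIMSEQ_realpow_zero) auto
    hence "eventually (\<lambda>k. q ^ k * D < e / 2) sequentially" using e by (intro order_tendstoD(2)) auto
    then obtain k0 where k0: "\<And>k. k \<ge> k0 \<Longrightarrow> q ^ k * D < e / 2" by (auto simp: eventually_sequentially)
    show "\<forall>\<^sub>F n in sequentially. \<forall>x\<in>K. dist (U n x) (l x) < e"
    proof (rule eventually_sequentiallyI[of "n0 + k0"], intro ballI)
      fix n x assume n: "n0 + k0 \<le> n" and x: "x \<in> K"
      then obtain k where k: "n = n0 + k" "k \<ge> k0" by (metis add.assoc add_le_cancel_left le_Suc_ex le_add1)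
      show "dist (U n x) (l x) < e" using main[OF x, of k] k0[OF k(2)] by (simp add: k E_def dist_norm)
    qed
  qed
qed simp

text \<open>By compactness the disks of one radius \<open>d\<close> around the points of \<open>K\<close> lie in a compact subset of \<open>S\<close>,
and Cauchy's estimate on these disks bounds the derivative of \<open>f n - g\<close> by its supremum divided by \<open>d\<close>.\<close>
lemma uniform_limit_deriv_on_compact:
  fixes f :: "nat \<Rightarrow> complex \<Rightarrow> complex"
  assumes S: "open S" and f: "\<And>n. f n holomorphic_on S" and g: "g holomorphic_on S"
    and lim: "\<And>K. compact K \<Longrightarrow> K \<subseteq> S \<Longrightarrow> uniform_limit K f g sequentially"
    and K: "compact K" "K \<subseteq> S"
  shows "uniform_limit K (\<lambda>n. deriv (f n)) (deriv g) sequentially"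
proof -
  obtain d where d: "d > 0" "(\<Union>x\<in>K. cball x d) \<subseteq> S"
    using compact_subset_open_imp_cball_epsilon_subset[OF K(1) S K(2)] by auto
  define K' where "K' = (\<Union>x\<in>K. \<Union>y\<in>cball 0 d. {x + y})"
  have "compact K'" unfolding K'_def by (intro compact_sums' K compact_cball)
  have K': "cball x d \<subseteq> K'" if "x \<in> K" for x
  proof
    fix y assume "y \<in> cball x d"
    thus "y \<in> K'" unfolding K'_def using that
      by (intro UN_I[of x] UN_I[of "y - x"]) (auto simp: dist_norm norm_minus_commute)
  qed
  have "K' \<subseteq> S"
  proof
    fix y assume "y \<in> K'"
    then obtain x u where "x \<in> K" "norm u \<le> d" "y = x + u" by (auto simp: K'_def)
    hence "y \<in> cball x d" by (simp add: dist_norm)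
    thus "y \<in> S" using d(2) \<open>x \<in> K\<close> by blast
  qed
  have ul: "uniform_limit K' f g sequentially" by (rule lim) fact+
  show ?thesis
  proof (rule uniform_limitI)
    fix e :: real assume "e > 0"
    hence "e * d / 2 > 0" using d by simp
    from uniform_limitD[OF ul this]
    show "\<forall>\<^sub>F n in sequentially. \<forall>x\<in>K. dist (deriv (f n) x) (deriv g x) < e"
    proof eventually_elim
      case (elim n)
      show ?case
      proof
        fix x assume x: "x \<in> K"
        have sub: "cball x d \<subseteq> S" using d(2) x by auto
        have h: "(\<lambda>w. f n w - g w) holomorphic_on S" by (intro holomorphic_intros f g)
        have "cmod ((deriv ^^ 1) (\<lambda>w. f n w - g w) x) \<le> fact 1 * (e * d / 2) / d ^ 1"
        proof (rule Cauchy_inequality)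
          show "(\<lambda>w. f n w - g w) holomorphic_on ball x d"
            using h sub by (meson ball_subset_cball holomorphic_on_subset)
          show "continuous_on (cball x d) (\<lambda>w. f n w - g w)"
            using h sub by (meson holomorphic_on_imp_continuous_on holomorphic_on_subset)
          fix y assume "cmod (x - y) = d"
          hence "y \<in> K'" using K'[OF x] by (auto simp: dist_norm)
          thus "cmod (f n y - g y) \<le> e * d / 2" using elim by (force simp: dist_norm)
        qed (use d in auto)
        moreover have "deriv (\<lambda>w. f n w - g w) x = deriv (f n) x - deriv g x"
          using f g S sub x K by (intro deriv_diff) (auto intro: holomorphic_on_imp_differentiable_at)
        ultimately have "cmod (deriv (f n) x - deriv g x) \<le> e / 2" using d by simp
        thus "dist (deriv (f n) x) (deriv g x) < e" using \<open>e > 0\<close> by (simp add: dist_norm)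
      qed
    qed
  qed
qed

section \<open>Real polynomials at complex arguments\<close>

lemma cpoly_0 [simp]: "cpoly 0 z = 0"
  and cpoly_1 [simp]: "cpoly 1 z = 1"
  and cpoly_pCons [simp]: "cpoly (pCons a P) z = of_real a + z * cpoly P z"
  and cpoly_smult [simp]: "cpoly (smult a P) z = of_real a * cpoly P z"
  by (simp_all add: cpoly_def map_poly_pCons map_poly_smult)

lemma cpoly_add [simp]: "cpoly (P + Q) z = cpoly P z + cpoly Q z"
proof -
  have "map_poly complex_of_real (P + Q) = map_poly of_real P + map_poly of_real Q"
    by (intro poly_eqI) (simp add: coeff_map_poly)
  thus ?thesis by (simp add: cpoly_def)
qed

lemma cpoly_diff [simp]: "cpoly (P - Q) z = cpoly P z - cpoly Q z"
proof -
  have "map_poly complex_of_real (P - Q) = map_poly of_real P - map_poly of_real Q"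
    by (intro poly_eqI) (simp add: coeff_map_poly)
  thus ?thesis by (simp add: cpoly_def)
qed

lemma cpoly_sum: "cpoly (sum F A) z = (\<Sum>i\<in>A. cpoly (F i) z)"
  by (induction A rule: infinite_finite_induct) auto

lemma cpoly_monom [simp]: "cpoly (monom a n) z = of_real a * z ^ n"
  by (simp add: cpoly_def map_poly_monom poly_monom)

lemma cpoly_cnj: "cpoly P (cnj z) = cnj (cpoly P z)"
  by (induction P) simp_all

lemma cpoly_of_real: "cpoly P (of_real x) = of_real (poly P x)"
  by (induction P) simp_all

lemma cpoly_as_sum: "cpoly P z = (\<Sum>i\<le>degree P. of_real (coeff P i) * z ^ i)"
proof -
  have "cpoly P z = cpoly (\<Sum>i\<le>degree P. monom (coeff P i) i) z"
    by (simp add: poly_as_sum_of_monoms)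
  thus ?thesis by (simp add: cpoly_sum)
qed

lemma cpoly_has_derivative [derivative_intros]:
  "(cpoly P has_field_derivative cpoly (pderiv P) z) (at z within S)"
proof (induction P)
  case 0
  have "cpoly 0 = (\<lambda>_. 0)" by (rule ext) simp
  thus ?case by simp
next
  case (pCons a P)
  have *: "cpoly (pCons a P) = (\<lambda>z. of_real a + z * cpoly P z)" by (rule ext) simp
  show ?case unfolding * by (rule derivative_eq_intros pCons refl)+ (simp add: pderiv_pCons)
qed

lemma cpoly_holomorphic: "cpoly P holomorphic_on S"
  using cpoly_has_derivative by (metis holomorphic_onI field_differentiable_def)

lemma cpoly_continuous_on [continuous_intros]:
  assumes "continuous_on S g" shows "continuous_on S (\<lambda>x. cpoly P (g x))"
proof -
  have "continuous_on UNIV (cpoly P)"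
    by (rule holomorphic_on_imp_continuous_on[OF cpoly_holomorphic])
  thus ?thesis using assms by (rule continuous_on_compose2) auto
qed

text \<open>The mean value property of the harmonic function \<open>ln \<bar>P\<bar>\<close>. The real coefficients make the two
halves of the circle contribute equally.\<close>
lemma mean_ln_norm_cpoly:
  assumes nz: "\<And>z. norm z \<le> 1 \<Longrightarrow> cpoly P z \<noteq> 0"
  shows "((\<lambda>t. ln (norm (cpoly P (cis t)))) has_integral pi * ln (norm (cpoly P 0))) {0..pi}"
proof -
  define U where "U = {z. cpoly P z \<noteq> 0}"
  have "open U"
  proof -
    have "open ((cpoly P) -` (- {0}))"
      by (intro open_vimage holomorphic_on_imp_continuous_on cpoly_holomorphic) auto
    moreover have "(cpoly P) -` (- {0}) = U" by (auto simp: U_def)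
    ultimately show ?thesis by simp
  qed
  have "cball 0 1 \<subseteq> U" using nz by (auto simp: U_def)
  then obtain e where e: "e > 0" "(\<Union>x\<in>cball (0::complex) 1. cball x e) \<subseteq> U"
    using compact_subset_open_imp_cball_epsilon_subset[OF _ \<open>open U\<close>, of "cball 0 1"] by auto
  \<comment> \<open>A slightly larger disk is still zero-free, so the logarithm is holomorphic across the circle.\<close>
  have sub: "ball 0 (1 + e) \<subseteq> U"
  proof
    fix z :: complex assume z: "z \<in> ball 0 (1 + e)"
    show "z \<in> U"
    proof (cases "norm z \<le> 1")
      case True thus ?thesis using \<open>cball 0 1 \<subseteq> U\<close> by auto
    next
      case False
      have "dist (sgn z) z \<le> e"
      proof -
        have z0: "z \<noteq> 0" using False by auto
        have "sgn z - z = of_real (1 / norm z - 1) * z"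
          using z0 by (simp add: sgn_eq field_simps)
        hence "dist (sgn z) z = \<bar>1 / norm z - 1\<bar> * norm z"
          by (simp add: dist_norm norm_mult del: of_real_diff of_real_divide)
        also have "\<dots> = norm z - 1" using False z0 by (simp add: field_simps abs_if)
        finally show ?thesis using z by simp
      qed
      moreover have "norm (sgn z) \<le> 1" by (simp add: norm_sgn)
      ultimately have "z \<in> (\<Union>x\<in>cball 0 1. cball x e)" by (intro UN_I[of "sgn z"]) auto
      thus ?thesis using e(2) by blast
    qed
  qed
  obtain g where g: "g holomorphic_on ball 0 (1+e)" "\<And>z. z \<in> ball 0 (1+e) \<Longrightarrow> exp (g z) = cpoly P z"
    by (rule holomorphic_logarithm_exists[of "ball 0 (1+e)" "cpoly P" 0])
       (use e sub in \<open>auto simp: U_def intro: cpoly_holomorphic\<close>)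
  have reg: "Re (g z) = ln (norm (cpoly P z))" if "norm z < 1 + e" for z
    using g(2)[of z] that norm_exp_eq_Re[of "g z"] by simp
  have "g holomorphic_on cball 0 1" using g(1) e(1) by (rule_tac holomorphic_on_subset) auto
  from Cauchy_integral_circlepath_simple[OF this, of 0]
  have "((\<lambda>u. g u / u) has_contour_integral (2 * of_real pi * \<i> * g 0)) (part_circlepath 0 1 0 (2*pi))"
    by (simp add: circlepath_def)
  hence "((\<lambda>t. g (cis t) / cis t * \<i> * cis t) has_integral (2 * of_real pi * \<i> * g 0)) {0..2*pi}"
    by (subst (asm) has_contour_integral_part_circlepath_iff) auto
  hence "((\<lambda>t. \<i> * g (cis t)) has_integral (2 * of_real pi * \<i> * g 0)) {0..2*pi}"
    by (simp add: mult_ac)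
  hence "((\<lambda>t. Im (\<i> * g (cis t))) has_integral Im (2 * of_real pi * \<i> * g 0)) {0..2*pi}"
    by (rule has_integral_Im)
  hence full: "((\<lambda>t. ln (norm (cpoly P (cis t)))) has_integral 2 * pi * ln (norm (cpoly P 0))) {0..2*pi}"
    using e(1) by (simp add: reg)
  define h where "h = (\<lambda>t. ln (norm (cpoly P (cis t))))"
  \<comment> \<open>Cauchy's formula gives the integral over the full circle; the symmetry halves it.\<close>
  have hsym: "h (2 * pi - t) = h t" for t
  proof -
    have "cis (2 * pi - t) = cnj (cis t)" by (simp add: complex_eq_iff)
    thus ?thesis by (simp add: h_def cpoly_cnj)
  qed
  have "continuous_on {0..pi} h"
    unfolding h_def by (intro continuous_intros) (use nz in auto)
  then obtain I where I: "(h has_integral I) {0..pi}"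
    using integrable_continuous_real by blast
  have "((\<lambda>x. h (-1 *\<^sub>R x + 2*pi)) has_integral (1/\<bar>-1\<bar>^DIM(real)) *\<^sub>R I) ((\<lambda>x. (1/-1) *\<^sub>R x + -((1/-1) *\<^sub>R (2*pi))) ` cbox 0 pi)"
    by (rule has_integral_affinity) (use I in auto)
  moreover have "(\<lambda>x. 2 * pi - x) ` cbox 0 pi = {pi..2*pi}"
    by (auto simp: image_iff intro!: bexI[of _ "2*pi - _"])
  ultimately have "(h has_integral I) {pi..2*pi}"
    using hsym by simp
  from has_integral_combine[OF _ _ I this]
  have "(h has_integral (I + I)) {0..2*pi}" by simp
  with full have "I + I = 2 * pi * ln (norm (cpoly P 0))"
    unfolding h_def by (rule has_integral_unique[OF _ , rotated])
  thus ?thesis using I by (simp add: h_def)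
qed

section \<open>From ratio asymptotics to the intensity\<close>

definition quot :: "(nat \<Rightarrow> real poly) \<Rightarrow> nat \<Rightarrow> nat \<Rightarrow> complex \<Rightarrow> complex" where
  "quot p n j z = cpoly (p j) z / cpoly (p n) z"

definition dquot :: "(nat \<Rightarrow> real poly) \<Rightarrow> nat \<Rightarrow> nat \<Rightarrow> complex \<Rightarrow> complex" where
  "dquot p n j z = (cpoly (pderiv (p j)) z * cpoly (p n) z - cpoly (p j) z * cpoly (pderiv (p n)) z)
                     / (cpoly (p n) z)\<^sup>2"

text \<open>The Gram matrix of the vectors \<open>(s\<^sub>j)\<close> and \<open>(s\<^sub>j')\<close>, \<open>j \<le> n\<close>, where \<open>s\<^sub>j = p\<^sub>j / p\<^sub>n\<close>.\<close>
definition gram00 where "gram00 p n z = (\<Sum>j\<le>n. quot p n j z * cnj (quot p n j z))"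
definition gram01 where "gram01 p n z = (\<Sum>j\<le>n. quot p n j z * cnj (dquot p n j z))"
definition gram11 where "gram11 p n z = (\<Sum>j\<le>n. dquot p n j z * cnj (dquot p n j z))"

lemma dquot_deriv:
  assumes "cpoly (p n) z \<noteq> 0"
  shows "(quot p n j has_field_derivative dquot p n j z) (at z)"
  unfolding quot_def dquot_def using assms
  by (auto intro!: derivative_eq_intros simp: power2_eq_square)

lemma cnj_gram00: "cnj (gram00 p n z) = gram00 p n z"
  by (simp add: gram00_def mult.commute)

text \<open>With \<open>F = p\<^sub>n\<close> one has \<open>p\<^sub>j = F s\<^sub>j\<close> and \<open>p\<^sub>j' = F' s\<^sub>j + F s\<^sub>j'\<close>. The second relation adds a multiple of
\<open>(s\<^sub>j)\<close> to \<open>F (s\<^sub>j')\<close>, which does not change the Gram determinant, so \<open>F'\<close> cancels.\<close>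
lemma intensity_eq_gram:
  assumes nz: "cpoly (p n) z \<noteq> 0"
  shows "intensity p n z = Re ((gram11 p n z * gram00 p n z - gram01 p n z * cnj (gram01 p n z))
                                 / (gram00 p n z * gram00 p n z)) / pi"
proof -
  define F where "F = cpoly (p n) z"
  define F' where "F' = cpoly (pderiv (p n)) z"
  define A where "A = gram00 p n z"
  define C where "C = gram01 p n z"
  define D where "D = gram11 p n z"
  have F: "F \<noteq> 0" using nz by (simp add: F_def)
  have c0: "cpoly (p j) z = F * quot p n j z" for j using F by (simp add: F_def quot_def)
  have c1: "cpoly (pderiv (p j)) z = F' * quot p n j z + F * dquot p n j z" for j
    using F by (simp add: F_def F'_def quot_def dquot_def field_simps power2_eq_square)
  have K: "kernel p n z z = F * cnj F * A"
    unfolding kernel_def c0 A_def gram00_def by (simp add: sum_distrib_left mult_ac)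
  have K01: "kernel01 p n z z = F * cnj F' * A + F * cnj F * C"
    unfolding kernel01_def c1 unfolding c0 A_def C_def gram00_def gram01_def
    by (simp add: sum_distrib_left mult_ac distrib_left sum.distrib)
  have C': "cnj C = (\<Sum>j\<le>n. dquot p n j z * cnj (quot p n j z))"
    by (simp add: C_def gram01_def mult.commute)
  have K11: "kernel11 p n z z = F' * cnj F' * A + F' * cnj F * C + F * cnj F' * cnj C + F * cnj F * D"
    unfolding kernel11_def c1 C' unfolding A_def C_def D_def gram00_def gram01_def gram11_def
    by (simp add: sum_distrib_left algebra_simps sum.distrib)
  have cA: "cnj A = A" by (simp add: A_def cnj_gram00)
  have num: "kernel11 p n z z * kernel p n z z - kernel01 p n z z * cnj (kernel01 p n z z)
              = (F * cnj F)\<^sup>2 * (D * A - C * cnj C)"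
    unfolding K K01 K11 by (simp add: cA algebra_simps power2_eq_square)
  have den: "kernel p n z z * kernel p n z z = (F * cnj F)\<^sup>2 * (A * A)"
    unfolding K by (simp add: power2_eq_square mult_ac)
  have quo: "(kernel11 p n z z * kernel p n z z - kernel01 p n z z * cnj (kernel01 p n z z))
          / (kernel p n z z * kernel p n z z) = (D * A - C * cnj C) / (A * A)"
    unfolding num den using F by simp
  have "intensity p n z = Re (complex_of_real ((Re (kernel11 p n z z) * Re (kernel p n z z)
      - (cmod (kernel01 p n z z))\<^sup>2) / (Re (kernel p n z z) * Re (kernel p n z z)))) / pi"
    by (simp add: intensity_def power2_eq_square)
  also have "complex_of_real ((Re (kernel11 p n z z) * Re (kernel p n z z)
      - (cmod (kernel01 p n z z))\<^sup>2) / (Re (kernel p n z z) * Re (kernel p n z z)))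
     = (kernel11 p n z z * kernel p n z z - kernel01 p n z z * cnj (kernel01 p n z z))
          / (kernel p n z z * kernel p n z z)"
    by (simp add: complex_norm_square[symmetric] flip: kernel_diag_real)
  finally show ?thesis unfolding quo A_def C_def D_def .
qed

lemma quot_Suc:
  assumes "cpoly (p n) z \<noteq> 0"
  shows "quot p (Suc n) j z = quot p (Suc n) n z * quot p n j z"
  using assms by (simp add: quot_def)

lemma dquot_Suc:
  assumes "cpoly (p n) z \<noteq> 0" "cpoly (p (Suc n)) z \<noteq> 0"
  shows "dquot p (Suc n) j z = dquot p (Suc n) n z * quot p n j z + quot p (Suc n) n z * dquot p n j z"
  using assms by (simp add: quot_def dquot_def field_simps power2_eq_square)

lemma quot_self: "cpoly (p n) z \<noteq> 0 \<Longrightarrow> quot p n n z = 1"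
  and dquot_self: "dquot p n n z = 0"
  by (simp_all add: quot_def dquot_def)

text \<open>The product rule for \<open>g s\<^sub>j\<close>, together with the new last entry \<open>1\<close>, whose derivative is \<open>0\<close>.\<close>
lemma gram_Suc:
  assumes nz: "cpoly (p n) z \<noteq> 0" "cpoly (p (Suc n)) z \<noteq> 0"
  defines "g \<equiv> quot p (Suc n) n z" and "g' \<equiv> dquot p (Suc n) n z"
  shows "gram00 p (Suc n) z = (g * cnj g) * gram00 p n z + 1"
    and "gram01 p (Suc n) z = (g * cnj g) * gram01 p n z + g * cnj g' * gram00 p n z"
    and "gram11 p (Suc n) z = (g * cnj g) * gram11 p n z
           + (g' * cnj g' * gram00 p n z + g' * cnj g * gram01 p n z + g * cnj g' * cnj (gram01 p n z))"
proof -
  have s: "quot p (Suc n) j z = g * quot p n j z" for j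
    unfolding g_def by (rule quot_Suc) (rule nz)
  have ds: "dquot p (Suc n) j z = g' * quot p n j z + g * dquot p n j z" for j
    unfolding g_def g'_def by (rule dquot_Suc) (rule nz)+
  note last = quot_self[of p "Suc n" z, OF nz(2)] dquot_self[of p "Suc n" z]
  show "gram00 p (Suc n) z = (g * cnj g) * gram00 p n z + 1"
    unfolding gram00_def sum.atMost_Suc last unfolding s by (simp add: sum_distrib_left mult_ac)
  show "gram01 p (Suc n) z = (g * cnj g) * gram01 p n z + g * cnj g' * gram00 p n z"
    unfolding gram00_def gram01_def sum.atMost_Suc last unfolding s ds
    by (simp add: sum_distrib_left algebra_simps sum.distrib)
  have C': "cnj (gram01 p n z) = (\<Sum>j\<le>n. dquot p n j z * cnj (quot p n j z))"
    by (simp add: gram01_def mult.commute)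
  show "gram11 p (Suc n) z = (g * cnj g) * gram11 p n z
           + (g' * cnj g' * gram00 p n z + g' * cnj g * gram01 p n z + g * cnj g' * cnj (gram01 p n z))"
    unfolding C' unfolding gram00_def gram01_def gram11_def sum.atMost_Suc last unfolding s ds
    by (simp add: sum_distrib_left algebra_simps sum.distrib)
qed

lemma compact_cont_bounded:
  "compact K \<Longrightarrow> continuous_on K (f :: complex \<Rightarrow> complex) \<Longrightarrow> bounded (f ` K)"
  by (intro compact_imp_bounded compact_continuous_image)

text \<open>The three entries of the Gram matrix converge in turn, each limit entering the inhomogeneous term of
the next recursion.\<close>
theorem intensity_limit_of_ratio:
  fixes \<zeta> :: "complex \<Rightarrow> complex"
  assumes S: "open S" and hol: "\<zeta> holomorphic_on S" and less: "\<And>z. z \<in> S \<Longrightarrow> cmod (\<zeta> z) < 1"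
    and nz: "\<And>n z. z \<in> S \<Longrightarrow> cpoly (p n) z \<noteq> 0"
    and ratio: "\<And>K. compact K \<Longrightarrow> K \<subseteq> S \<Longrightarrow>
        uniform_limit K (\<lambda>n z. cpoly (p n) z / cpoly (p (Suc n)) z) \<zeta> sequentially"
    and K: "compact K" "K \<subseteq> S"
  shows "uniform_limit K (intensity p)
           (\<lambda>z. (cmod (deriv \<zeta> z))\<^sup>2 / (pi * (1 - (cmod (\<zeta> z))\<^sup>2)\<^sup>2)) sequentially"
proof (cases "K = {}")
  case False
  define g where "g = (\<lambda>n. quot p (Suc n) n)"
  define g' where "g' = (\<lambda>n. dquot p (Suc n) n)"
  define \<zeta>' where "\<zeta>' = deriv \<zeta>"
  have nzK: "cpoly (p n) z \<noteq> 0" if "z \<in> K" for n z using nz that K by auto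
  have g_lim: "uniform_limit K g \<zeta> sequentially"
    unfolding g_def quot_def[abs_def] by (rule ratio[OF K])
  have g_DERIV: "(g n has_field_derivative g' n z) (at z)" if "z \<in> S" for n z
    unfolding g_def g'_def by (rule dquot_deriv) (use nz that in auto)
  hence g_der: "deriv (g n) z = g' n z" if "z \<in> S" for n z
    using that by (simp add: DERIV_imp_deriv)
  have g_hol: "g n holomorphic_on S" for n
    using g_DERIV S by (auto simp: holomorphic_on_open)
  have "uniform_limit K (\<lambda>n. deriv (g n)) \<zeta>' sequentially"
    unfolding \<zeta>'_def
    by (rule uniform_limit_deriv_on_compact[OF S g_hol hol _ K]) (unfold g_def quot_def[abs_def], rule ratio)
  hence g'_lim: "uniform_limit K g' \<zeta>' sequentially"
    by (subst (asm) uniform_limit_cong'[where g = g' and i = \<zeta>']) (use g_der K in auto)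
  have cont: "continuous_on K \<zeta>" "continuous_on K \<zeta>'"
    unfolding \<zeta>'_def using hol holomorphic_deriv[OF hol S] K
    by (meson holomorphic_on_imp_continuous_on holomorphic_on_subset)+
  have "continuous_on K (\<lambda>z. cmod (\<zeta> z))" using cont by (intro continuous_intros)
  then obtain z0 where z0: "z0 \<in> K" "\<And>z. z \<in> K \<Longrightarrow> cmod (\<zeta> z) \<le> cmod (\<zeta> z0)"
    using continuous_attains_sup[OF K(1) False] by blast
  define \<rho> where "\<rho> = (cmod (\<zeta> z0))\<^sup>2"
  have \<rho>: "\<rho> < 1" using less[of z0] z0 K by (auto simp: \<rho>_def abs_square_less_1)
  define \<tau> where "\<tau> = (\<lambda>z. \<zeta> z * cnj (\<zeta> z))"
  have tau: "cmod (\<tau> z) \<le> \<rho>" if "z \<in> K" for z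
    using z0(2)[OF that] by (simp add: \<tau>_def \<rho>_def norm_mult power2_eq_square mult_mono)
  have tau1: "1 - \<tau> z \<noteq> 0" if "z \<in> K" for z using tau[OF that] \<rho> by auto
  note bd = compact_cont_bounded[OF K(1)]
  note cnj_lim = bounded_linear.uniform_limit[OF bounded_linear_cnj]
  have t_lim: "uniform_limit K (\<lambda>n z. g n z * cnj (g n z)) \<tau> sequentially"
    unfolding \<tau>_def by (intro uniform_lim_mult g_lim cnj_lim bd continuous_intros cont)
  have gcont: "continuous_on K (g n)" for n
    using g_hol K by (meson holomorphic_on_imp_continuous_on holomorphic_on_subset)
  have qcont: "continuous_on K (quot p n j)" "continuous_on K (dquot p n j)" for n j
    unfolding quot_def[abs_def] dquot_def[abs_def] by (intro continuous_intros; use nzK in auto)+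
  have contn: "continuous_on K (gram00 p n)" "continuous_on K (gram01 p n)" "continuous_on K (gram11 p n)" for n
    unfolding gram00_def[abs_def] gram01_def[abs_def] gram11_def[abs_def]
    by (intro continuous_intros qcont)+
  have rec: "gram00 p (Suc n) z = (g n z * cnj (g n z)) * gram00 p n z + 1"
    "gram01 p (Suc n) z = (g n z * cnj (g n z)) * gram01 p n z + g n z * cnj (g' n z) * gram00 p n z"
    "gram11 p (Suc n) z = (g n z * cnj (g n z)) * gram11 p n z + (g' n z * cnj (g' n z) * gram00 p n z
        + g' n z * cnj (g n z) * gram01 p n z + g n z * cnj (g' n z) * cnj (gram01 p n z))"
    if "z \<in> K" for n z
    unfolding g_def g'_def by (rule gram_Suc; rule nzK[OF that])+
  define A where "A = (\<lambda>z. 1 / (1 - \<tau> z))"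
  define C where "C = (\<lambda>z. \<zeta> z * cnj (\<zeta>' z) * A z / (1 - \<tau> z))"
  define D where "D = (\<lambda>z. (\<zeta>' z * cnj (\<zeta>' z) * A z + \<zeta>' z * cnj (\<zeta> z) * C z
                              + \<zeta> z * cnj (\<zeta>' z) * cnj (C z)) / (1 - \<tau> z))"
  have cont\<tau>: "continuous_on K \<tau>" unfolding \<tau>_def by (intro continuous_intros cont)
  have contA: "continuous_on K A" unfolding A_def by (intro continuous_intros cont\<tau>) (use tau1 in auto)
  have contC: "continuous_on K C" unfolding C_def by (intro continuous_intros cont\<tau> contA cont) (use tau1 in auto)
  have contD: "continuous_on K D" unfolding D_def by (intro continuous_intros cont\<tau> contA contC cont) (use tau1 in auto)
  have A_lim: "uniform_limit K (gram00 p) A sequentially"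
    unfolding A_def
    by (rule uniform_limit_affine_recursion[OF rec(1) t_lim _ _ tau \<rho>])
       (auto intro!: bd contn uniform_limit_const continuous_intros)
  have C_lim: "uniform_limit K (gram01 p) C sequentially"
    unfolding C_def
    by (rule uniform_limit_affine_recursion[OF rec(2) t_lim _ _ tau \<rho>])
       (auto intro!: bd contn uniform_lim_mult continuous_intros g_lim g'_lim cnj_lim A_lim cont contA)
  have D_lim: "uniform_limit K (gram11 p) D sequentially"
    unfolding D_def
    by (rule uniform_limit_affine_recursion[OF rec(3) t_lim _ _ tau \<rho>])
       (auto intro!: bd contn uniform_lim_mult uniform_limit_add continuous_intros g_lim g'_lim cnj_lim
          A_lim C_lim cont contA contC)
  \<comment> \<open>The denominator of the limit stays away from \<open>0\<close> because \<open>\<bar>1 - \<tau>\<bar> \<le> 2\<close>.\<close>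
  have A_ge: "1/4 \<le> cmod (A z * A z)" if "z \<in> K" for z
  proof -
    have "cmod (1 - \<tau> z) \<le> 2" using tau[OF that] \<rho> norm_triangle_ineq4[of 1 "\<tau> z"] by simp
    moreover have "cmod (1 - \<tau> z) > 0" using tau1[OF that] by simp
    ultimately have "1/2 \<le> cmod (A z)" by (simp add: A_def norm_divide field_simps)
    hence "1/2 * (1/2) \<le> cmod (A z) * cmod (A z)" by (intro mult_mono) auto
    thus ?thesis by (simp add: norm_mult)
  qed
  have quo: "uniform_limit K (\<lambda>n z. (gram11 p n z * gram00 p n z - gram01 p n z * cnj (gram01 p n z))
                                 / (gram00 p n z * gram00 p n z))
              (\<lambda>z. (D z * A z - C z * cnj (C z)) / (A z * A z)) sequentially"
    by (rule uniform_lim_divide[OF _ _ _ A_ge])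
       (auto intro!: uniform_limit_minus uniform_lim_mult bd continuous_intros A_lim C_lim D_lim cnj_lim
          contA contC contD)
  have "uniform_limit K (\<lambda>n z. Re ((gram11 p n z * gram00 p n z - gram01 p n z * cnj (gram01 p n z))
                                 / (gram00 p n z * gram00 p n z)) / pi)
              (\<lambda>z. Re ((D z * A z - C z * cnj (C z)) / (A z * A z)) / pi) sequentially"
    by (intro bounded_linear.uniform_limit[OF bounded_linear_divide] bounded_linear.uniform_limit[OF bounded_linear_Re] quo)
  moreover have "Re ((D z * A z - C z * cnj (C z)) / (A z * A z)) / pi
      = (cmod (deriv \<zeta> z))\<^sup>2 / (pi * (1 - (cmod (\<zeta> z))\<^sup>2)\<^sup>2)" if z: "z \<in> K" for z
  proof -
    define x where "x = \<zeta> z"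
    define y where "y = \<zeta>' z"
    define a where "a = A z"
    have tz: "\<tau> z = of_real ((cmod x)\<^sup>2)" by (simp add: \<tau>_def x_def complex_norm_square[symmetric])
    have a: "a = of_real (1 / (1 - (cmod x)\<^sup>2))" by (simp add: a_def A_def tz)
    have ca: "cnj a = a" by (simp add: a)
    have a0: "a \<noteq> 0" using tau1[OF z] by (simp add: a_def A_def)
    have at: "a * (1 - x * cnj x) = 1" using tau1[OF z] by (simp add: a_def A_def \<tau>_def x_def)
    have Cz: "C z = x * cnj y * a\<^sup>2" by (simp add: C_def A_def a_def x_def y_def power2_eq_square)
    have "D z = (y * cnj y * a + y * cnj x * C z + x * cnj y * cnj (C z)) * a"
      by (simp add: D_def A_def a_def x_def y_def)
    hence Dz: "D z = y * cnj y * a\<^sup>2 * (1 + 2 * (x * cnj x) * a)"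
      unfolding Cz by (simp add: ca algebra_simps power2_eq_square)
    have "D z * a - C z * cnj (C z) = y * cnj y * a^3 * (1 + x * cnj x * a)"
      unfolding Dz unfolding Cz by (simp add: ca algebra_simps power2_eq_square power3_eq_cube)
    also have "1 + x * cnj x * a = a" using at by (simp add: algebra_simps)
    finally have "(D z * a - C z * cnj (C z)) / (a * a) = y * cnj y * a\<^sup>2"
      using a0 by (simp add: power2_eq_square power3_eq_cube)
    also have "\<dots> = of_real ((cmod y)\<^sup>2 * (1 / (1 - (cmod x)\<^sup>2))\<^sup>2)"
      unfolding a complex_norm_square[symmetric] by simp
    finally show ?thesis unfolding a_def x_def y_def \<zeta>'_def by (simp add: power_divide)
  qed
  ultimately show ?thesis
    by (subst (asm) uniform_limit_cong'[where g = "intensity p" and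
          i = "\<lambda>z. (cmod (deriv \<zeta> z))\<^sup>2 / (pi * (1 - (cmod (\<zeta> z))\<^sup>2)\<^sup>2)"])
       (auto simp: intensity_eq_gram nzK)
qed simp

section \<open>The conformal map onto the disk and the limit density\<close>

lemma real_mem_unit_segment:
  assumes "-1 \<le> r" "r \<le> 1"
  shows "complex_of_real r \<in> closed_segment (-1) 1"
proof -
  have "r \<in> closed_segment (-1) 1" using assms by (auto simp: closed_segment_eq_real_ivl)
  thus ?thesis using of_real_closed_segment[of r "-1" 1, where 'a = complex] by simp
qed

lemma sqrt_branch_domain:
  fixes z :: complex
  assumes "z \<notin> closed_segment (-1) 1"
  shows "z \<noteq> 0" "1 - 1 / z\<^sup>2 \<notin> \<real>\<^sub>\<le>\<^sub>0"
proof -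
  show z0: "z \<noteq> 0" using real_mem_unit_segment[of 0] assms by auto
  show "1 - 1 / z\<^sup>2 \<notin> \<real>\<^sub>\<le>\<^sub>0"
  proof
    assume "1 - 1 / z\<^sup>2 \<in> \<real>\<^sub>\<le>\<^sub>0"
    then obtain r where r: "r \<le> 0" "1 - 1 / z\<^sup>2 = complex_of_real r" by (auto elim!: nonpos_Reals_cases)
    define c where "c = sqrt (1 / (1 - r))"
    have r1: "1 - complex_of_real r \<noteq> 0"
      using r(1) by (metis of_real_1 of_real_diff of_real_eq_0_iff diff_ge_0_iff_ge not_one_le_zero order_trans eq_iff_diff_eq_0)
    have "z\<^sup>2 * (1 - of_real r) = 1" unfolding r(2)[symmetric] using z0 by (simp add: field_simps)
    hence "z\<^sup>2 = 1 / (1 - of_real r)" using r1 by (simp add: field_simps)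
    also have "\<dots> = of_real (1 / (1 - r))" by simp
    also have "1 / (1 - r) = c\<^sup>2" using r(1) by (simp add: c_def)
    finally have "z\<^sup>2 = (of_real c)\<^sup>2" by simp
    hence "z = of_real c \<or> z = of_real (- c)" by (simp add: power2_eq_iff)
    moreover have "0 \<le> c" "c \<le> 1" using r(1) by (auto simp: c_def real_sqrt_le_1_iff)
    ultimately show False
      using assms real_mem_unit_segment[of c] real_mem_unit_segment[of "-c"] by auto
  qed
qed

lemma sqrt_branch_props:
  assumes "z \<notin> closed_segment (-1) 1"
  shows "(sqrt_branch z)\<^sup>2 = z\<^sup>2 - 1" "cmod (z + sqrt_branch z) > 1"
  using theI'[OF sqrt_branch_ex1[OF assms]] unfolding sqrt_branch_def by auto

text \<open>Off \<open>[-1, 1]\<close> the argument \<open>1 - 1/z\<^sup>2\<close> avoids the branch cut, so its principal root \<open>c\<close> has positive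
real part; hence \<open>\<bar>1 + c\<bar> > \<bar>1 - c\<bar>\<close>, which singles out the root with \<open>\<bar>z + z c\<bar> > 1\<close>. This
expression for the branch shows that it is holomorphic.\<close>
lemma sqrt_branch_eq_csqrt:
  assumes "z \<notin> closed_segment (-1) 1"
  shows "sqrt_branch z = z * csqrt (1 - 1 / z\<^sup>2)"
proof -
  define c where "c = csqrt (1 - 1 / z\<^sup>2)"
  note dom = sqrt_branch_domain[OF assms]
  have sq: "(z * c)\<^sup>2 = z\<^sup>2 - 1" using dom(1) by (simp add: c_def power_mult_distrib field_simps)
  have "Re c \<noteq> 0"
  proof
    assume "Re c = 0"
    hence "c\<^sup>2 \<in> \<real>\<^sub>\<le>\<^sub>0" by (simp add: complex_nonpos_Reals_iff power2_eq_square)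
    thus False using dom(2) by (simp add: c_def)
  qed
  hence "Re c > 0" using csqrt_principal[of "1 - 1 / z\<^sup>2"] by (auto simp: c_def)
  have "cmod (1 - c) < cmod (1 + c)"
  proof -
    have "(cmod (1 - c))\<^sup>2 < (cmod (1 + c))\<^sup>2"
      unfolding cmod_power2 using \<open>Re c > 0\<close> by (simp add: power2_eq_square algebra_simps)
    thus ?thesis by (simp add: power2_less_imp_less)
  qed
  hence "cmod (z - z * c) < cmod (z + z * c)"
    using dom(1) norm_mult[of z "1 - c"] norm_mult[of z "1 + c"] by (simp add: algebra_simps)
  moreover have "cmod (z + z * c) * cmod (z - z * c) = 1"
  proof -
    have "(z + z * c) * (z - z * c) = 1" using sq by (simp add: algebra_simps power2_eq_square)
    thus ?thesis by (metis norm_mult norm_one)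
  qed
  ultimately have "cmod (z + z * c) > 1"
    by (smt (verit) mult_le_one mult_less_cancel_left2 norm_ge_zero mult_mono)
  with sq have "(z * c)\<^sup>2 = z\<^sup>2 - 1 \<and> cmod (z + z * c) > 1" by simp
  thus ?thesis unfolding sqrt_branch_def c_def[symmetric]
    using sqrt_branch_ex1[OF assms] by (intro the1_equality)
qed

lemma open_off_segment: "open (- closed_segment (-1) (1::complex))"
  by (simp add: open_Compl closed_segment)

definition zeta :: "complex \<Rightarrow> complex" where
  "zeta z = z - sqrt_branch z"

lemma zeta_props:
  assumes "z \<notin> closed_segment (-1) 1"
  shows "(z + sqrt_branch z) * zeta z = 1" "zeta z \<noteq> 0" "cmod (zeta z) < 1"
    "z + sqrt_branch z = 1 / zeta z" "z = (zeta z + 1 / zeta z) / 2" "sqrt_branch z \<noteq> 0"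
proof -
  note p = sqrt_branch_props[OF assms]
  show m: "(z + sqrt_branch z) * zeta z = 1"
    using p(1) by (simp add: zeta_def algebra_simps power2_eq_square)
  show nz: "zeta z \<noteq> 0" using m by auto
  show inv: "z + sqrt_branch z = 1 / zeta z" using m nz by (simp add: field_simps)
  have "cmod (1 / zeta z) > 1" using p(2) unfolding inv .
  thus "cmod (zeta z) < 1" using nz by (simp add: norm_divide)
  show "z = (zeta z + 1 / zeta z) / 2" unfolding inv[symmetric] by (simp add: zeta_def)
  have "z\<^sup>2 \<noteq> 1\<^sup>2"
  proof
    assume "z\<^sup>2 = 1\<^sup>2"
    hence "z = 1 \<or> z = -1" by (simp only: power2_eq_iff)
    thus False using assms by auto
  qed
  thus "sqrt_branch z \<noteq> 0" using p(1) by auto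
qed

lemma sqrt_branch_holomorphic: "sqrt_branch holomorphic_on - closed_segment (-1) 1"
proof -
  have "(\<lambda>z. z * csqrt (1 - 1 / z\<^sup>2)) holomorphic_on - closed_segment (-1) 1"
    by (intro holomorphic_intros) (use sqrt_branch_domain in auto)
  thus ?thesis by (rule holomorphic_transform) (simp add: sqrt_branch_eq_csqrt)
qed

lemma zeta_holomorphic: "zeta holomorphic_on - closed_segment (-1) 1"
  unfolding zeta_def by (intro holomorphic_intros sqrt_branch_holomorphic)

text \<open>Differentiating \<open>s\<^sup>2 = z\<^sup>2 - 1\<close> gives \<open>s' = z / s\<close>.\<close>
lemma deriv_zeta:
  assumes z: "z \<notin> closed_segment (-1) 1"
  shows "deriv zeta z = - zeta z / sqrt_branch z"
proof -
  let ?S = "- closed_segment (-1) (1::complex)"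
  define d where "d = deriv sqrt_branch z"
  have d: "(sqrt_branch has_field_derivative d) (at z)"
    unfolding d_def using holomorphic_derivI[OF sqrt_branch_holomorphic open_off_segment] z by auto
  have "((\<lambda>z. (sqrt_branch z)\<^sup>2) has_field_derivative 2 * sqrt_branch z * d) (at z)"
    by (rule derivative_eq_intros d refl)+ (simp add: mult_ac)
  moreover have "((\<lambda>z. (sqrt_branch z)\<^sup>2) has_field_derivative 2 * z) (at z)"
  proof (rule has_field_derivative_transform_within_open[of "\<lambda>z. z\<^sup>2 - 1" _ _ ?S])
    show "((\<lambda>z. z\<^sup>2 - 1) has_field_derivative 2 * z) (at z)"
      by (rule derivative_eq_intros refl)+ simp
  qed (use z open_off_segment sqrt_branch_props in auto)
  ultimately have "2 * sqrt_branch z * d = 2 * z" by (rule DERIV_unique)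
  hence d2: "d = z / sqrt_branch z" using zeta_props(6)[OF z] by (simp add: field_simps)
  have "(zeta has_field_derivative 1 - d) (at z)"
    unfolding zeta_def by (intro derivative_intros d)
  hence "deriv zeta z = 1 - d" by (rule DERIV_imp_deriv)
  thus ?thesis using zeta_props(6)[OF z] by (simp add: d2 zeta_def field_simps)
qed

text \<open>Up to a constant factor, the pull-back under \<^const>\<open>zeta\<close> of the hyperbolic area density of the disk.\<close>
definition hyp_density :: "complex \<Rightarrow> real" where
  "hyp_density z = (cmod (deriv zeta z))\<^sup>2 / (pi * (1 - (cmod (zeta z))\<^sup>2)\<^sup>2)"

text \<open>Both sides are rational in the real and imaginary parts of \<open>\<xi> = 1 / \<zeta>\<close>, because \<open>1 / \<xi>\<close> is the
conjugate of \<open>\<xi>\<close> divided by \<open>\<bar>\<xi>\<bar>\<^sup>2\<close>.\<close>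
lemma limit_formula_eq:
  assumes z: "z \<notin> closed_segment (-1) 1" and "Im z \<noteq> 0"
  shows "limit_formula z = hyp_density z"
proof -
  note zp = zeta_props[OF z]
  define \<xi> where "\<xi> = z + sqrt_branch z"
  define a b r where "a = Re \<xi>" and "b = Im \<xi>" and "r = a\<^sup>2 + b\<^sup>2"
  have r: "(cmod \<xi>)\<^sup>2 = r" by (simp add: r_def a_def b_def cmod_power2)
  have "cmod \<xi> > 1" using sqrt_branch_props(2)[OF z] by (simp add: \<xi>_def)
  hence r1: "r > 1" unfolding r[symmetric] by simp
  have zxi: "zeta z = 1 / \<xi>" using zp(2,4) by (simp add: \<xi>_def)
  have "\<xi> \<noteq> 0" using \<open>cmod \<xi> > 1\<close> by auto
  have zc: "zeta z = cnj \<xi> / of_real r"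
    unfolding zxi r[symmetric] using \<open>\<xi> \<noteq> 0\<close> complex_norm_square[of \<xi>] by (simp add: field_simps)
  have zeta2: "(cmod (zeta z))\<^sup>2 = 1 / r" by (simp add: zxi norm_divide power_divide r)
  have "z = (\<xi> + zeta z) / 2" by (simp add: \<xi>_def zeta_def)
  hence "Im z = Im ((\<xi> + cnj \<xi> / of_real r) / 2)" unfolding zc by (rule arg_cong)
  hence "Im z = (b - b / r) / 2" by (simp add: b_def)
  hence Imz: "Im z = b * (r - 1) / (2 * r)" using r1 by (simp add: field_simps)
  hence b0: "b \<noteq> 0" using assms(2) by auto
  have "sqrt_branch z = (\<xi> - zeta z) / 2" by (simp add: \<xi>_def zeta_def)
  hence "Re (sqrt_branch z) = Re ((\<xi> - cnj \<xi> / of_real r) / 2)"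
    "Im (sqrt_branch z) = Im ((\<xi> - cnj \<xi> / of_real r) / 2)" unfolding zc by (rule arg_cong)+
  hence "Re (sqrt_branch z) = (a - a / r) / 2" "Im (sqrt_branch z) = (b + b / r) / 2"
    by (simp_all add: a_def b_def)
  hence "Re (sqrt_branch z) = a * (r - 1) / (2 * r)" "Im (sqrt_branch z) = b * (r + 1) / (2 * r)"
    using r1 by (simp_all add: field_simps)
  hence s2: "(cmod (sqrt_branch z))\<^sup>2 = (a\<^sup>2 * (r - 1)\<^sup>2 + b\<^sup>2 * (r + 1)\<^sup>2) / (4 * r\<^sup>2)"
    by (simp add: cmod_power2 power_divide power_mult_distrib add_divide_distrib)
  define s where "s = (cmod (sqrt_branch z))\<^sup>2"
  have "s > 0" using zp(6) by (simp add: s_def)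
  have zz: "cmod (z\<^sup>2 - 1) = s"
    unfolding s_def using sqrt_branch_props(1)[OF z] by (simp flip: norm_power)
  have key: "4 * r\<^sup>2 * s - (r - 1)\<^sup>2 * r = 4 * b\<^sup>2 * r"
  proof -
    have "4 * r\<^sup>2 * s = a\<^sup>2 * (r - 1)\<^sup>2 + b\<^sup>2 * (r + 1)\<^sup>2" using r1 by (simp add: s_def s2)
    thus ?thesis by (simp add: r_def algebra_simps power2_eq_square)
  qed
  have "limit_formula z = 1 / (4 * pi * (Im z)\<^sup>2) * (1 - (Im z)\<^sup>2 * r / (s * b\<^sup>2))"
    unfolding limit_formula_def \<xi>_def[symmetric] zz r b_def ..
  also have "(Im z)\<^sup>2 * r / (s * b\<^sup>2) = (r - 1)\<^sup>2 * r / (4 * r\<^sup>2 * s)"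
    unfolding Imz using b0 by (simp add: power_mult_distrib power_divide)
  also have "1 - (r - 1)\<^sup>2 * r / (4 * r\<^sup>2 * s) = 4 * b\<^sup>2 * r / (4 * r\<^sup>2 * s)"
    unfolding key[symmetric] using r1 \<open>s > 0\<close> by (simp add: diff_divide_distrib)
  also have "1 / (4 * pi * (Im z)\<^sup>2) * (4 * b\<^sup>2 * r / (4 * r\<^sup>2 * s)) = r / (pi * s * (r - 1)\<^sup>2)"
  proof -
    define d where "d = r - 1"
    have "d \<noteq> 0" using r1 by (simp add: d_def)
    thus ?thesis unfolding Imz d_def[symmetric] using b0 r1 \<open>s > 0\<close>
      by (simp add: field_simps power2_eq_square)
  qed
  also have "\<dots> = hyp_density z"
  proof -
    have "(cmod (deriv zeta z))\<^sup>2 = 1 / (r * s)"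
      unfolding deriv_zeta[OF z] by (simp add: norm_divide power_divide zeta2 s_def)
    moreover have "1 - (cmod (zeta z))\<^sup>2 = (r - 1) / r" using r1 by (simp add: zeta2 field_simps)
    ultimately show ?thesis unfolding hyp_density_def
      using r1 \<open>s > 0\<close> by (simp add: power_divide) (simp add: power2_eq_square)
  qed
  finally show ?thesis .
qed

lemma hyp_density_continuous_on: "continuous_on (- closed_segment (-1) 1) hyp_density"
proof -
  have "cmod (zeta z) ^ 2 \<noteq> 1" if "z \<in> - closed_segment (-1) 1" for z
    using zeta_props(3)[of z] that by (auto simp: power2_eq_1_iff) (metis norm_ge_zero neg_0_le_iff_le not_one_le_zero)
  thus ?thesis
    unfolding hyp_density_def
    by (intro continuous_intros holomorphic_on_imp_continuous_on zeta_holomorphic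
              holomorphic_deriv open_off_segment) auto
qed

lemma limit_intensity_eq:
  assumes z: "z \<notin> closed_segment (-1) 1"
  shows "limit_intensity z = hyp_density z"
proof (cases "Im z = 0")
  case True
  let ?F = "at z within {u. Im u \<noteq> 0}"
  have ev: "eventually (\<lambda>u. u \<in> - closed_segment (-1) 1) (nhds z)"
    using z by (intro eventually_nhds_in_open open_off_segment) auto
  have "z islimpt {u. Im u \<noteq> 0}"
    unfolding islimpt_approachable
  proof (intro allI impI)
    fix e :: real assume "e > 0"
    thus "\<exists>x'\<in>{u. Im u \<noteq> 0}. x' \<noteq> z \<and> dist x' z < e"
      by (intro bexI[of _ "z + \<i> * of_real (e/2)"]) (auto simp: dist_norm norm_mult True)
  qed
  hence nt: "\<not> trivial_limit ?F" by (simp add: trivial_limit_within)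
  have "isCont hyp_density z"
    using hyp_density_continuous_on open_off_segment z by (auto simp: continuous_on_eq_continuous_at)
  hence "(hyp_density \<longlongrightarrow> hyp_density z) ?F"
    unfolding isCont_def by (rule tendsto_within_subset) simp
  moreover have "eventually (\<lambda>u. hyp_density u = limit_formula u) ?F"
    unfolding eventually_at_filter using ev by eventually_elim (auto simp: limit_formula_eq)
  ultimately have "(limit_formula \<longlongrightarrow> hyp_density z) ?F" by (rule Lim_transform_eventually)
  thus ?thesis using True tendsto_Lim[OF nt] by (simp add: limit_intensity_def)
qed (simp add: limit_intensity_def limit_formula_eq z)

section \<open>Szego recursion on the circle\<close>

lemma cmod_moebius_diff:
  fixes x y :: complex and a :: real
  shows "(cmod (x - of_real a * y))\<^sup>2 - (cmod (y - of_real a * x))\<^sup>2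
           = (1 - a\<^sup>2) * ((cmod x)\<^sup>2 - (cmod y)\<^sup>2)"
  unfolding cmod_power2 by (simp add: power2_eq_square algebra_simps)

lemma cnj_cis_mult: "cis t * cnj (cis t) = 1" "cnj (cis t) * cis t = 1"
  by (simp_all add: complex_eq_iff power2_eq_square[symmetric])

lemma inverse_cis_eq_cnj: "1 / cis t = cnj (cis t)"
  by (simp add: cis_cnj divide_conv_cnj)

text \<open>The function \<open>f\<close> on \<open>[0, \<pi>]\<close> represents an even weight on the unit circle. For real polynomials the
two half circles contribute complex conjugate values, so one half suffices.\<close>
locale szego_weight =
  fixes f :: "real \<Rightarrow> real"
  assumes weight_integrable: "set_integrable lebesgue {0..pi} f"
    and weight_nonneg: "t \<in> {0..pi} \<Longrightarrow> 0 \<le> f t"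
    and weight_pos: "AE t in lebesgue. t \<in> {0..pi} \<longrightarrow> 0 < f t"
    and ln_weight_integrable: "set_integrable lebesgue {0..pi} (\<lambda>t. ln (f t))"
begin

text \<open>Half of the inner product in the weighted \<open>L\<^sup>2\<close> space of the circle.\<close>
definition circ_inner :: "real poly \<Rightarrow> real poly \<Rightarrow> real" where
  "circ_inner P Q = (LINT t:{0..pi}|lebesgue. Re (cpoly P (cis t) * cnj (cpoly Q (cis t))) * f t)"

lemma continuous_times_weight_integrable:
  assumes "continuous_on {0..pi} h"
  shows "set_integrable lebesgue {0..pi} (\<lambda>t. h t * f t)"
proof (rule absolutely_integrable_bounded_measurable_product_real)
  show "h \<in> borel_measurable (lebesgue_on {0..pi})"
    using assms by (intro continuous_imp_measurable_on_sets_lebesgue) auto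
  show "bounded (h ` {0..pi})"
    using assms by (intro compact_imp_bounded compact_continuous_image) auto
qed (use weight_integrable in auto)

lemma circ_inner_integrable:
  "set_integrable lebesgue {0..pi} (\<lambda>t. Re (cpoly P (cis t) * cnj (cpoly Q (cis t))) * f t)"
  by (intro continuous_times_weight_integrable continuous_intros)

lemma circ_inner_cong:
  assumes "\<And>t. Re (cpoly P (cis t) * cnj (cpoly Q (cis t))) = Re (cpoly P' (cis t) * cnj (cpoly Q' (cis t)))"
  shows "circ_inner P Q = circ_inner P' Q'"
  by (simp only: circ_inner_def assms)

lemma circ_inner_commute: "circ_inner P Q = circ_inner Q P"
  by (rule circ_inner_cong) (simp add: mult_ac)

lemma circ_inner_add_left: "circ_inner (P + P') Q = circ_inner P Q + circ_inner P' Q"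
  unfolding circ_inner_def by (subst set_integral_add(2)[symmetric, OF circ_inner_integrable circ_inner_integrable])
    (simp add: algebra_simps)

lemma circ_inner_diff_left: "circ_inner (P - P') Q = circ_inner P Q - circ_inner P' Q"
  unfolding circ_inner_def by (subst set_integral_diff(2)[symmetric, OF circ_inner_integrable circ_inner_integrable])
    (simp add: algebra_simps)

lemma circ_inner_smult_left: "circ_inner (smult a P) Q = a * circ_inner P Q"
  unfolding circ_inner_def by (subst set_integral_mult_right[symmetric]) (simp add: algebra_simps)

lemma circ_inner_zero_left: "circ_inner 0 Q = 0"
  using circ_inner_smult_left[of 0 0 Q] by simp

lemma circ_inner_sum_left: "circ_inner (sum F A) Q = (\<Sum>i\<in>A. circ_inner (F i) Q)"
  by (induction A rule: infinite_finite_induct) (auto simp: circ_inner_zero_left circ_inner_add_left)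


lemma circ_inner_right:
  "circ_inner Q (P + P') = circ_inner Q P + circ_inner Q P'" "circ_inner Q (P - P') = circ_inner Q P - circ_inner Q P'" "circ_inner Q (smult a P) = a * circ_inner Q P"
  using circ_inner_add_left[of P P' Q] circ_inner_diff_left[of P P' Q] circ_inner_smult_left[of a P Q]
  by (simp_all add: circ_inner_commute)

lemmas circ_inner_linear = circ_inner_add_left circ_inner_diff_left circ_inner_smult_left circ_inner_right

lemma circ_inner_expand_right:
  assumes "degree Q \<le> n"
  shows "circ_inner P Q = (\<Sum>i\<le>n. coeff Q i * circ_inner P (monom 1 i))"
proof -
  have "circ_inner Q P = circ_inner (\<Sum>i\<le>n. smult (coeff Q i) (monom 1 i)) P"
    by (simp add: smult_monom poly_as_sum_of_monoms'[OF assms])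
  thus ?thesis by (simp add: circ_inner_sum_left circ_inner_smult_left circ_inner_commute[of P Q] circ_inner_commute[of P "monom _ _"])
qed

lemma circ_inner_shift: "circ_inner (pCons 0 P) (pCons 0 Q) = circ_inner P Q"
proof (rule circ_inner_cong)
  fix t
  have "cpoly (pCons 0 P) (cis t) * cnj (cpoly (pCons 0 Q) (cis t))
          = (cis t * cnj (cis t)) * (cpoly P (cis t) * cnj (cpoly Q (cis t)))"
    by (simp add: mult_ac)
  thus "Re (cpoly (pCons 0 P) (cis t) * cnj (cpoly (pCons 0 Q) (cis t)))
          = Re (cpoly P (cis t) * cnj (cpoly Q (cis t)))"
    by (simp only: cnj_cis_mult mult_1)
qed

lemma circ_inner_self: "circ_inner P P = (LINT t:{0..pi}|lebesgue. (cmod (cpoly P (cis t)))\<^sup>2 * f t)"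
  unfolding circ_inner_def by (simp add: complex_mult_cnj cmod_power2)

text \<open>A nonzero polynomial has finitely many zeros on the arc, and the weight is positive almost everywhere.\<close>
lemma circ_inner_self_pos:
  assumes "P \<noteq> 0" shows "circ_inner P P > 0"
proof -
  define h where "h = (\<lambda>t. (cmod (cpoly P (cis t)))\<^sup>2 * f t)"
  have int: "set_integrable lebesgue {0..pi} h"
    unfolding h_def by (intro continuous_times_weight_integrable continuous_intros)
  define Z where "Z = cis -` {z. cpoly P z = 0} \<inter> {0..pi}"
  have "inj_on cis {0..pi}"
  proof (rule inj_onI)
    fix x y assume "x \<in> {0..pi}" "y \<in> {0..pi}" "cis x = cis y"
    thus "x = y" using cos_inj_pi[of x y] by (simp add: complex_eq_iff)
  qed
  moreover have "finite {z. cpoly P z = 0}"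
    unfolding cpoly_def using assms by (intro poly_roots_finite) (simp add: map_poly_eq_0_iff)
  ultimately have "finite Z" unfolding Z_def by (intro finite_vimage_IntI)
  hence "Z \<in> null_sets lebesgue" using negligible_finite negligible_iff_null_sets by blast
  hence "AE t in lebesgue. t \<notin> Z" by (rule AE_not_in)
  with weight_pos have pos: "AE t\<in>{0..pi} in lebesgue. 0 < indicator {0..pi} t *\<^sub>R h t"
    by eventually_elim (auto simp: h_def Z_def)
  have "circ_inner P P \<noteq> 0"
  proof
    assume "circ_inner P P = 0"
    moreover have "(LINT t:{0..pi}|lebesgue. indicator {0..pi} t *\<^sub>R h t) = (LINT t:{0..pi}|lebesgue. h t)"
      by (rule set_lebesgue_integral_cong) auto
    ultimately have "(LINT t:{0..pi}|lebesgue. indicator {0..pi} t *\<^sub>R h t) = 0"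
      by (simp add: circ_inner_self h_def)
    hence "{0..pi} \<in> null_sets lebesgue"
      using null_if_pos_func_has_zero_int[OF _ _ pos] int by (simp add: set_integrable_def)
    hence "emeasure lebesgue {0..pi} = 0" by blast
    thus False by simp
  qed
  moreover have "circ_inner P P \<ge> 0"
    unfolding circ_inner_self set_lebesgue_integral_def
    by (intro integral_nonneg_AE) (auto simp: weight_nonneg split: split_indicator)
  ultimately show ?thesis by simp
qed

text \<open>The Szego recursion for the monic orthogonal polynomial \<open>\<Phi>\<^sub>n\<close> and its reversal \<open>\<Psi>\<^sub>n(z) = z\<^sup>n \<Phi>\<^sub>n(1/z)\<close>.
The coefficient \<open>a\<close> is chosen to make \<open>\<Phi>\<^sub>n\<^sub>+\<^sub>1\<close> orthogonal to \<open>1\<close>.\<close>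
primrec szego_pair :: "nat \<Rightarrow> real poly \<times> real poly" where
  "szego_pair 0 = (1, 1)"
| "szego_pair (Suc n) = (let F = fst (szego_pair n); G = snd (szego_pair n); a = circ_inner (pCons 0 F) 1 / circ_inner G 1
                in (pCons 0 F - smult a G, G - smult a (pCons 0 F)))"

definition Phi where "Phi n = fst (szego_pair n)"
definition Psi where "Psi n = snd (szego_pair n)"
definition verblunsky where "verblunsky n = circ_inner (pCons 0 (Phi n)) 1 / circ_inner (Psi n) 1"
definition Phi_sqnorm where "Phi_sqnorm n = circ_inner (Phi n) (Phi n)"

lemma Phi_0 [simp]: "Phi 0 = 1" and Psi_0 [simp]: "Psi 0 = 1"
  by (simp_all add: Phi_def Psi_def)

lemma Phi_Suc: "Phi (Suc n) = pCons 0 (Phi n) - smult (verblunsky n) (Psi n)"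
  and Psi_Suc: "Psi (Suc n) = Psi n - smult (verblunsky n) (pCons 0 (Phi n))"
  by (simp_all add: Phi_def Psi_def verblunsky_def Let_def)

lemma degree_Phi_Psi: "degree (Phi n) \<le> n \<and> degree (Psi n) \<le> n"
proof (induction n)
  case (Suc n)
  have "degree (pCons 0 (Phi n)) \<le> Suc n" using Suc by (simp add: degree_pCons_le order_trans[OF degree_pCons_le])
  moreover have "degree (smult (verblunsky n) (Psi n)) \<le> Suc n" "degree (smult (verblunsky n) (pCons 0 (Phi n))) \<le> Suc n"
    using Suc \<open>degree (pCons 0 (Phi n)) \<le> Suc n\<close> by (simp_all add: order_trans[OF degree_smult_le])
  ultimately show ?case using Suc unfolding Phi_Suc Psi_Suc
    by (intro conjI degree_diff_le) auto
qed simp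

lemma coeff_Phi_n [simp]: "coeff (Phi n) n = 1"
proof (induction n)
  case (Suc n)
  have "coeff (Psi n) (Suc n) = 0" using degree_Phi_Psi[of n] by (intro coeff_eq_0) auto
  thus ?case using Suc by (simp add: Phi_Suc)
qed simp

lemma coeff_Psi_0 [simp]: "coeff (Psi n) 0 = 1"
  by (induction n) (simp_all add: Psi_Suc)

lemma cpoly_Psi_0 [simp]: "cpoly (Psi n) 0 = 1"
  by (induction n) (simp_all add: Psi_Suc)

lemma reversal:
  assumes "z \<noteq> 0"
  shows "cpoly (Psi n) z = z ^ n * cpoly (Phi n) (1 / z) \<and> cpoly (Phi n) z = z ^ n * cpoly (Psi n) (1 / z)"
proof (induction n)
  case (Suc n)
  thus ?case using assms by (simp add: Phi_Suc Psi_Suc algebra_simps)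
qed simp

lemma Psi_cis: "cpoly (Psi n) (cis t) = cis t ^ n * cnj (cpoly (Phi n) (cis t))"
  using conjunct1[OF reversal[of "cis t" n]] by (simp only: inverse_cis_eq_cnj cpoly_cnj cis_neq_zero not_False_eq_True)

lemma norm_Psi_cis: "cmod (cpoly (Psi n) (cis t)) = cmod (cpoly (Phi n) (cis t))"
  by (simp add: Psi_cis norm_mult norm_power)

lemma circ_inner_Psi_Psi: "circ_inner (Psi n) (Psi n) = Phi_sqnorm n"
  unfolding Phi_sqnorm_def circ_inner_self norm_Psi_cis ..

lemma circ_inner_Psi_monom:
  assumes "j \<le> n"
  shows "circ_inner (Psi n) (monom 1 j) = circ_inner (Phi n) (monom 1 (n - j))"
proof (rule circ_inner_cong)
  fix t
  have "cis t ^ n * cnj (cis t) ^ j = cis t ^ (n - j) * (cis t * cnj (cis t)) ^ j"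
    using assms by (simp add: power_mult_distrib flip: power_add)
  hence "cis t ^ n * cnj (cis t) ^ j = cis t ^ (n - j)" by (simp add: cnj_cis_mult)
  hence "cpoly (Psi n) (cis t) * cnj (cpoly (monom 1 j) (cis t))
           = cnj (cpoly (Phi n) (cis t) * cnj (cpoly (monom 1 (n - j)) (cis t)))"
    by (simp add: Psi_cis mult_ac)
  thus "Re (cpoly (Psi n) (cis t) * cnj (cpoly (monom 1 j) (cis t)))
          = Re (cpoly (Phi n) (cis t) * cnj (cpoly (monom 1 (n - j)) (cis t)))"
    by (metis complex_cnj(1) cnj.sel(1))
qed

lemma Phi_sqnorm_pos: "Phi_sqnorm n > 0"
proof -
  have "Phi n \<noteq> 0" using coeff_Phi_n[of n] by (metis coeff_0 zero_neq_one)
  thus ?thesis unfolding Phi_sqnorm_def by (rule circ_inner_self_pos)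
qed

text \<open>Orthogonality is a hypothesis here because its inductive proof uses that this value is not \<open>0\<close>.\<close>
lemma circ_inner_Psi_1_if:
  assumes "\<And>j. j < n \<Longrightarrow> circ_inner (Phi n) (monom 1 j) = 0"
  shows "circ_inner (Psi n) 1 = Phi_sqnorm n"
proof -
  have "Phi_sqnorm n = (\<Sum>i\<le>n. coeff (Phi n) i * circ_inner (Phi n) (monom 1 i))"
    unfolding Phi_sqnorm_def using degree_Phi_Psi by (intro circ_inner_expand_right) auto
  also have "\<dots> = circ_inner (Phi n) (monom 1 n)"
    by (subst sum.remove[of _ n]) (auto intro!: sum.neutral simp: assms)
  also have "\<dots> = circ_inner (Psi n) (monom 1 0)" by (subst circ_inner_Psi_monom) auto
  finally show ?thesis by (simp add: monom_0 one_pCons)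
qed

text \<open>Multiplication by \<open>z\<close> is isometric on the circle, so \<open>z \<Phi>\<^sub>n\<close> is orthogonal to \<open>z, \<dots>, z\<^sup>n\<close>; so is the
reversal \<open>\<Psi>\<^sub>n\<close>. Orthogonality to \<open>1\<close> is the choice of the coefficient.\<close>
lemma Phi_orthogonal: "j < n \<Longrightarrow> circ_inner (Phi n) (monom 1 j) = 0"
proof (induction n arbitrary: j)
  case (Suc n)
  have Phi_sqnorm: "circ_inner (Psi n) 1 = Phi_sqnorm n" by (rule circ_inner_Psi_1_if) (rule Suc.IH)
  show ?case
  proof (cases j)
    case 0
    thus ?thesis using Phi_sqnorm Phi_sqnorm_pos[of n]
      by (simp add: Phi_Suc circ_inner_linear monom_0 verblunsky_def flip: one_pCons)
  next
    case (Suc i)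
    hence i: "i < n" using Suc.prems by simp
    have "circ_inner (pCons 0 (Phi n)) (monom 1 j) = 0"
      using Suc.IH[OF i] by (simp add: Suc monom_Suc circ_inner_shift)
    moreover have "circ_inner (Psi n) (monom 1 j) = 0"
      using Suc i by (simp add: circ_inner_Psi_monom Suc.IH)
    ultimately show ?thesis by (simp add: Phi_Suc circ_inner_linear)
  qed
qed simp

lemma circ_inner_Psi_1: "circ_inner (Psi n) 1 = Phi_sqnorm n"
  by (rule circ_inner_Psi_1_if) (rule Phi_orthogonal)

lemma Psi_orthogonal: "1 \<le> j \<Longrightarrow> j \<le> n \<Longrightarrow> circ_inner (Psi n) (monom 1 j) = 0"
  by (simp add: circ_inner_Psi_monom Phi_orthogonal)

text \<open>Of the powers of \<open>z\<close> in \<open>\<Psi>\<^sub>n\<close> all but the constant term \<open>1\<close> are orthogonal to \<open>z \<Phi>\<^sub>n\<close>.\<close>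
lemma circ_inner_zPhi_Psi: "circ_inner (pCons 0 (Phi n)) (Psi n) = verblunsky n * Phi_sqnorm n"
proof -
  have "circ_inner (pCons 0 (Phi n)) (Psi n) = (\<Sum>i\<le>n. coeff (Psi n) i * circ_inner (pCons 0 (Phi n)) (monom 1 i))"
    using degree_Phi_Psi by (intro circ_inner_expand_right) auto
  also have "\<dots> = circ_inner (pCons 0 (Phi n)) (monom 1 0)"
  proof (subst sum.remove[of _ 0])
    have "circ_inner (pCons 0 (Phi n)) (monom 1 i) = 0" if "i \<in> {..n} - {0}" for i
      using that by (cases i) (auto simp: monom_Suc circ_inner_shift Phi_orthogonal)
    thus "coeff (Psi n) 0 * circ_inner (pCons 0 (Phi n)) (monom 1 0) +
      (\<Sum>i\<in>{..n} - {0}. coeff (Psi n) i * circ_inner (pCons 0 (Phi n)) (monom 1 i)) =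
      circ_inner (pCons 0 (Phi n)) (monom 1 0)" by simp
  qed auto
  also have "\<dots> = verblunsky n * Phi_sqnorm n"
    using Phi_sqnorm_pos[of n] by (simp add: verblunsky_def circ_inner_Psi_1 monom_0 flip: one_pCons)
  finally show ?thesis .
qed

lemma Phi_sqnorm_Suc: "Phi_sqnorm (Suc n) = (1 - (verblunsky n)\<^sup>2) * Phi_sqnorm n"
proof -
  have "Phi_sqnorm (Suc n) = circ_inner (pCons 0 (Phi n)) (pCons 0 (Phi n)) - 2 * verblunsky n * circ_inner (pCons 0 (Phi n)) (Psi n)
           + (verblunsky n)\<^sup>2 * circ_inner (Psi n) (Psi n)"
    unfolding Phi_sqnorm_def Phi_Suc by (simp add: circ_inner_linear circ_inner_commute[of "Psi n" "pCons 0 (Phi n)"] algebra_simps power2_eq_square del: smult_pCons)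
  thus ?thesis by (simp add: circ_inner_shift circ_inner_Psi_Psi circ_inner_zPhi_Psi Phi_sqnorm_def[symmetric] algebra_simps power2_eq_square)
qed

lemma circ_inner_Phi_Psi_Suc: "circ_inner (Phi (Suc n)) (Psi (Suc n)) = - verblunsky n * Phi_sqnorm (Suc n)"
  unfolding Phi_sqnorm_Suc unfolding Phi_Suc Psi_Suc
  by (simp add: circ_inner_linear circ_inner_shift circ_inner_Psi_Psi circ_inner_zPhi_Psi circ_inner_commute[of "Psi n" "pCons 0 (Phi n)"] Phi_sqnorm_def[symmetric]
       algebra_simps power2_eq_square del: smult_pCons)

lemma verblunsky_less_1: "\<bar>verblunsky n\<bar> < 1"
proof -
  have "(1 - (verblunsky n)\<^sup>2) * Phi_sqnorm n > 0" using Phi_sqnorm_pos[of "Suc n"] by (simp add: Phi_sqnorm_Suc)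
  hence "(verblunsky n)\<^sup>2 < 1" using Phi_sqnorm_pos[of n] by (simp add: zero_less_mult_iff)
  thus ?thesis by (simp add: abs_square_less_1)
qed

text \<open>In the closed disk \<open>\<bar>z \<Phi>\<^sub>n\<bar> \<le> \<bar>\<Psi>\<^sub>n\<bar>\<close>, and the recursion step acts on the pair \<open>(z \<Phi>\<^sub>n, \<Psi>\<^sub>n)\<close> by a
matrix that multiplies \<open>\<bar>\<Psi>\<bar>\<^sup>2 - \<bar>\<Phi>\<bar>\<^sup>2\<close> by \<open>1 - a\<^sub>n\<^sup>2 > 0\<close>.\<close>
lemma Psi_dominates:
  assumes "cmod z \<le> 1"
  shows "cpoly (Psi n) z \<noteq> 0 \<and> cmod (cpoly (Phi n) z) \<le> cmod (cpoly (Psi n) z)"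
proof (induction n)
  case (Suc n)
  define u where "u = z * cpoly (Phi n) z"
  define v where "v = cpoly (Psi n) z"
  have u: "cmod u \<le> cmod v" unfolding u_def v_def
    using Suc assms by (metis mult_left_le_one_le norm_ge_zero norm_mult order_trans)
  have v: "v \<noteq> 0" using Suc by (simp add: v_def)
  have "cmod (of_real (verblunsky n) * u) < cmod v"
  proof -
    have "cmod (of_real (verblunsky n) * u) \<le> \<bar>verblunsky n\<bar> * cmod v" using u by (simp add: norm_mult mult_left_mono)
    also have "\<dots> < 1 * cmod v" using v verblunsky_less_1[of n] by (intro mult_strict_right_mono) auto
    finally show ?thesis by simp
  qed
  hence nz: "v - of_real (verblunsky n) * u \<noteq> 0" by auto
  have "(cmod (v - of_real (verblunsky n) * u))\<^sup>2 - (cmod (u - of_real (verblunsky n) * v))\<^sup>2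
      = (1 - (verblunsky n)\<^sup>2) * ((cmod v)\<^sup>2 - (cmod u)\<^sup>2)" by (rule cmod_moebius_diff)
  also have "\<dots> \<ge> 0" using verblunsky_less_1[of n] u
    by (intro mult_nonneg_nonneg) (auto simp: abs_square_le_1 power_mono)
  finally have "(cmod (u - of_real (verblunsky n) * v))\<^sup>2 \<le> (cmod (v - of_real (verblunsky n) * u))\<^sup>2" by simp
  hence "cmod (u - of_real (verblunsky n) * v) \<le> cmod (v - of_real (verblunsky n) * u)"
    by (rule power2_le_imp_le) simp
  thus ?case using nz by (simp add: Phi_Suc Psi_Suc u_def v_def del: smult_pCons)
qed (simp)

text \<open>One step back, \<open>\<Phi>\<^sub>n + \<Psi>\<^sub>n\<close> is a nonzero multiple of \<open>z \<Phi> + \<Psi>\<close>, and \<open>\<bar>z \<Phi>\<bar> < \<bar>\<Psi>\<bar>\<close> in the open disk.\<close>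
lemma Psi_plus_Phi_nonzero:
  assumes "cmod z < 1" shows "cpoly (Phi n + Psi n) z \<noteq> 0"
proof (cases n)
  case (Suc m)
  define u where "u = z * cpoly (Phi m) z"
  define v where "v = cpoly (Psi m) z"
  have v: "v \<noteq> 0" and le: "cmod (cpoly (Phi m) z) \<le> cmod v"
    using Psi_dominates[of z m] assms by (auto simp: v_def)
  have u: "cmod u < cmod v"
  proof -
    have "cmod u \<le> cmod z * cmod v" unfolding u_def norm_mult using le by (intro mult_left_mono) auto
    also have "\<dots> < 1 * cmod v" using v assms by (intro mult_strict_right_mono) auto
    finally show ?thesis by simp
  qed
  have eq: "cpoly (Phi n + Psi n) z = of_real (1 - verblunsky m) * (u + v)"
    by (simp add: Suc Phi_Suc Psi_Suc u_def v_def algebra_simps del: smult_pCons)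
  have "u + v \<noteq> 0" using u by (metis add_eq_0_iff norm_minus_cancel less_irrefl)
  thus ?thesis unfolding eq using verblunsky_less_1[of m] by (simp del: of_real_diff)
next
  case 0
  have "cpoly (Phi 0 + Psi 0) z = 2" unfolding cpoly_add by simp
  thus ?thesis unfolding 0 by simp
qed

text \<open>The squared norm of \<open>\<Psi>\<^sub>n\<close> is at least \<open>\<pi>\<close> times the geometric mean of \<open>\<bar>\<Psi>\<^sub>n\<bar>\<^sup>2 f\<close>, and the factor \<open>\<bar>\<Psi>\<^sub>n\<bar>\<^sup>2\<close>
has geometric mean \<open>1\<close> since \<open>\<Psi>\<^sub>n\<close> is zero-free in the closed disk with \<open>\<Psi>\<^sub>n(0) = 1\<close>.\<close>
lemma Szego_lower_bound:
  defines "\<mu> \<equiv> (LINT t:{0..pi}|lebesgue. ln (f t)) / pi"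
  shows "Phi_sqnorm n \<ge> pi * exp \<mu>"
proof -
  let ?l = "\<lambda>t. ln (cmod (cpoly (Psi n) (cis t)))"
  define L where "L = exp \<mu>"
  have nz: "cpoly (Psi n) (cis t) \<noteq> 0" for t using Psi_dominates[of "cis t" n] by simp
  have cont: "continuous_on {0..pi} ?l" by (intro continuous_intros) (use nz in auto)
  have li: "set_integrable lebesgue {0..pi} ?l" using cont by (rule absolutely_integrable_continuous_real)
  have l0: "(LINT t:{0..pi}|lebesgue. ?l t) = 0"
  proof -
    have "(?l has_integral pi * ln (cmod (cpoly (Psi n) 0))) {0..pi}"
      by (rule mean_ln_norm_cpoly) (use Psi_dominates in blast)
    thus ?thesis using set_lebesgue_integral_eq_integral(2)[OF li] by (simp add: integral_unique)
  qed
  have c: "set_integrable lebesgue {0..pi} (\<lambda>_. L * (1 - \<mu>))"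
    by (rule absolutely_integrable_continuous_real) auto
  have "pi * L = (LINT t:{0..pi}|lebesgue. (L * (1 - \<mu>)) + (2 * L * ?l t + L * ln (f t)))"
  proof -
    have "(LINT t:{0..pi}|lebesgue. (L * (1 - \<mu>)) + (2 * L * ?l t + L * ln (f t)))
        = (LINT t:{0..pi}|lebesgue. L * (1 - \<mu>)) + ((LINT t:{0..pi}|lebesgue. 2 * L * ?l t)
            + (LINT t:{0..pi}|lebesgue. L * ln (f t)))"
      using li ln_weight_integrable c by (subst set_integral_add(2); simp)+
    also have "(LINT t:{0..pi}|lebesgue. L * (1 - \<mu>)) = pi * (L * (1 - \<mu>))"
      using set_lebesgue_integral_eq_integral(2)[OF c] by (simp add: mult_ac)
    also have "(LINT t:{0..pi}|lebesgue. 2 * L * ?l t) = 0" by (simp add: l0)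
    also have "(LINT t:{0..pi}|lebesgue. L * ln (f t)) = L * (pi * \<mu>)" by (simp add: \<mu>_def)
    finally show ?thesis by (simp add: algebra_simps)
  qed
  also have "\<dots> \<le> (LINT t:{0..pi}|lebesgue. (cmod (cpoly (Psi n) (cis t)))\<^sup>2 * f t)"
  proof (rule set_integral_mono_AE)
    show "set_integrable lebesgue {0..pi} (\<lambda>t. (L * (1 - \<mu>)) + (2 * L * ?l t + L * ln (f t)))"
      using li ln_weight_integrable c by auto
    show "set_integrable lebesgue {0..pi} (\<lambda>t. (cmod (cpoly (Psi n) (cis t)))\<^sup>2 * f t)"
      by (intro continuous_times_weight_integrable continuous_intros)
    show "AE t\<in>{0..pi} in lebesgue. L * (1 - \<mu>) + (2 * L * ?l t + L * ln (f t))
            \<le> (cmod (cpoly (Psi n) (cis t)))\<^sup>2 * f t"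
      using weight_pos
    proof eventually_elim
      case (elim t)
      show ?case
      proof
        assume t: "t \<in> {0..pi}"
        define c where "c = cmod (cpoly (Psi n) (cis t))"
        have c: "c > 0" using nz by (simp add: c_def)
        have ft: "f t > 0" using elim t by simp
        \<comment> \<open>The inequality \<open>ln x \<le> x - 1\<close>, scaled by the geometric mean \<open>L\<close>, integrates to the claim.\<close>
        define x where "x = c\<^sup>2 * f t / L"
        have "x > 0" using c ft by (simp add: x_def L_def)
        hence "ln x \<le> x - 1" by (rule ln_le_minus_one)
        moreover have "ln x = 2 * ln c + ln (f t) - \<mu>"
          using c ft by (simp add: x_def ln_mult ln_div L_def ln_realpow)
        ultimately have "L * (1 + (2 * ln c + ln (f t) - \<mu>)) \<le> L * x" by (simp add: L_def)
        also have "L * x = c\<^sup>2 * f t" by (simp add: x_def L_def)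
        finally show "L * (1 - \<mu>) + (2 * L * ln c + L * ln (f t)) \<le> c\<^sup>2 * f t"
          by (simp add: algebra_simps)
      qed
    qed
  qed
  finally show ?thesis unfolding circ_inner_Psi_Psi[symmetric] circ_inner_self L_def .
qed

lemma Phi_sqnorm_convergent: obtains l where "l > 0" "Phi_sqnorm \<longlonglongrightarrow> l"
proof -
  have dec: "decseq Phi_sqnorm"
    by (rule decseq_SucI) (simp add: Phi_sqnorm_Suc Phi_sqnorm_pos less_imp_le mult_left_le_one_le verblunsky_less_1 abs_square_le_1)
  define b where "b = pi * exp ((LINT t:{0..pi}|lebesgue. ln (f t)) / pi)"
  have b: "b \<le> Phi_sqnorm n" for n using Szego_lower_bound by (simp add: b_def)
  obtain l where l: "Phi_sqnorm \<longlonglongrightarrow> l" "\<And>i. l \<le> Phi_sqnorm i"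
    using decseq_convergent[OF dec, of b] b by blast
  have "b \<le> l" by (rule LIMSEQ_le_const[OF l(1)]) (use b in auto)
  moreover have "b > 0" by (simp add: b_def)
  ultimately show ?thesis using that[of l] l(1) by auto
qed

lemma verblunsky_tendsto_0: "verblunsky \<longlonglongrightarrow> 0"
proof -
  obtain l where l: "l > 0" "Phi_sqnorm \<longlonglongrightarrow> l" by (rule Phi_sqnorm_convergent)
  have "(\<lambda>n. 1 - Phi_sqnorm (Suc n) / Phi_sqnorm n) \<longlonglongrightarrow> 1 - l / l"
    by (intro tendsto_intros l(2) LIMSEQ_Suc) (use l in auto)
  moreover have "1 - Phi_sqnorm (Suc n) / Phi_sqnorm n = (verblunsky n)\<^sup>2" for n
    using Phi_sqnorm_pos[of n] by (simp add: Phi_sqnorm_Suc)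
  ultimately have "(\<lambda>n. (verblunsky n)\<^sup>2) \<longlonglongrightarrow> 0" using l by simp
  thus ?thesis by (simp add: tendsto_null_power)
qed

end

section \<open>Ratio asymptotics through the Joukowski map\<close>

lemma uniform_limit_by_bound:
  fixes f :: "nat \<Rightarrow> 'a \<Rightarrow> complex"
  assumes "\<And>n x. x \<in> K \<Longrightarrow> cmod (f n x - l x) \<le> b n" "b \<longlonglongrightarrow> 0"
  shows "uniform_limit K f l sequentially"
proof (rule uniform_limitI)
  fix e :: real assume "e > 0"
  with assms(2) have "eventually (\<lambda>n. b n < e) sequentially" by (rule order_tendstoD(2))
  thus "\<forall>\<^sub>F n in sequentially. \<forall>x\<in>K. dist (f n x) (l x) < e"
  proof eventually_elim
    case (elim n)
    show ?case using elim assms(1)[of _ n] by (auto simp: dist_norm intro: le_less_trans)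
  qed
qed

lemma uniform_limit_of_const:
  assumes "(c \<longlongrightarrow> l) F" shows "uniform_limit K (\<lambda>n _. c n) (\<lambda>_. l) F"
  by (rule uniform_limitI) (use tendstoD[OF assms] in \<open>auto elim: eventually_mono\<close>)

lemma bounded_const_image: "bounded ((\<lambda>_. c) ` S)"
  by (rule bounded_subset[of "{c}"]) auto

fun cheb :: "nat \<Rightarrow> real poly" where
  "cheb 0 = 1"
| "cheb (Suc 0) = [:0, 1:]"
| "cheb (Suc (Suc n)) = smult 2 (pCons 0 (cheb (Suc n))) - cheb n"

lemma cheb_degree: "degree (cheb n) \<le> n \<and> coeff (cheb n) n \<noteq> 0"
proof (induction n rule: cheb.induct)
  case (3 n)
  have "degree (smult 2 (pCons 0 (cheb (Suc n)))) \<le> Suc (Suc n)"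
    using 3(1) by (intro order_trans[OF degree_smult_le] order_trans[OF degree_pCons_le]) auto
  moreover have "coeff (cheb n) (Suc (Suc n)) = 0" using 3(2) by (intro coeff_eq_0) auto
  ultimately show ?case using 3 by (auto intro!: degree_diff_le simp del: smult_pCons)
qed auto

lemma degree_cheb [simp]: "degree (cheb n) = n"
  using cheb_degree[of n] by (meson le_antisym le_degree)

lemma cpoly_cheb_joukowski:
  assumes "z \<noteq> 0"
  shows "cpoly (cheb n) ((z + 1 / z) / 2) = (z ^ n + 1 / z ^ n) / 2"
proof (induction n rule: cheb.induct)
  case (3 n)
  define x where "x = (z + 1 / z) / 2"
  have "cpoly (cheb (Suc (Suc n))) x = 2 * x * cpoly (cheb (Suc n)) x - cpoly (cheb n) x"
    by (simp del: smult_pCons)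
  also have "\<dots> = (z ^ Suc (Suc n) + 1 / z ^ Suc (Suc n)) / 2"
    unfolding 3[folded x_def] unfolding x_def using assms by (simp add: field_simps)
  finally show ?case by (simp only: x_def)
qed auto

context szego_weight
begin

text \<open>The polynomial in \<open>x = (z + 1/z)/2\<close> that equals \<open>z\<^sup>-\<^sup>n (\<Phi>\<^sub>2\<^sub>n + \<Psi>\<^sub>2\<^sub>n)(z)\<close>. That function is invariant under
\<open>z \<mapsto> 1/z\<close>: a term \<open>z\<^sup>i\<^sup>-\<^sup>n\<close> from \<open>\<Phi>\<^sub>2\<^sub>n\<close> pairs with \<open>z\<^sup>n\<^sup>-\<^sup>i\<close> from \<open>\<Psi>\<^sub>2\<^sub>n\<close> to twice a Chebyshev
polynomial of degree \<open>\<bar>i - n\<bar>\<close>.\<close>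
definition folded_poly :: "nat \<Rightarrow> real poly" where
  "folded_poly n = (\<Sum>i\<le>degree (Phi (2 * n)). smult (2 * coeff (Phi (2 * n)) i) (cheb (nat \<bar>int i - int n\<bar>)))"

lemma degree_folded_poly: "degree (folded_poly n) \<le> n"
  unfolding folded_poly_def
proof (intro degree_sum_le)
  fix i assume "i \<in> {..degree (Phi (2 * n))}"
  hence "i \<le> 2 * n" using degree_Phi_Psi[of "2 * n"] by auto
  thus "degree (smult (2 * coeff (Phi (2 * n)) i) (cheb (nat \<bar>int i - int n\<bar>))) \<le> n"
    by (intro order_trans[OF degree_smult_le]) auto
qed auto

definition recip_poly where "recip_poly n = Phi (2 * n) + Psi (2 * n)"

lemma cpoly_folded_poly_joukowski:
  assumes z: "z \<noteq> 0"
  shows "z ^ n * cpoly (folded_poly n) ((z + 1 / z) / 2) = cpoly (recip_poly n) z"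
proof -
  let ?c = "\<lambda>i. complex_of_real (coeff (Phi (2 * n)) i)"
  have summand: "z ^ n * (z ^ nat \<bar>int i - int n\<bar> + 1 / z ^ nat \<bar>int i - int n\<bar>) = z ^ i + z ^ (2 * n) * (1 / z) ^ i"
    if "i \<in> {..degree (Phi (2 * n))}" for i
  proof (cases "i \<ge> n")
    case True
    then obtain k where k: "i = n + k" using le_Suc_ex by blast
    thus ?thesis using z by (simp add: field_simps power_add power_mult power2_eq_square)
  next
    case False
    then obtain k where k: "n = i + k" by (metis le_Suc_ex nat_le_linear)
    thus ?thesis using z by (simp add: field_simps power_add power_mult power2_eq_square)
  qed
  have "z ^ n * cpoly (folded_poly n) ((z + 1 / z) / 2)
      = (\<Sum>i\<le>degree (Phi (2 * n)). ?c i * (z ^ n * (z ^ nat \<bar>int i - int n\<bar> + 1 / z ^ nat \<bar>int i - int n\<bar>)))"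
    unfolding folded_poly_def cpoly_sum by (simp add: cpoly_cheb_joukowski[OF z] sum_distrib_left mult_ac)
  also have "\<dots> = (\<Sum>i\<le>degree (Phi (2 * n)). ?c i * (z ^ i + z ^ (2 * n) * (1 / z) ^ i))"
    by (intro sum.cong refl) (simp only: summand)
  also have "\<dots> = cpoly (Phi (2 * n)) z + z ^ (2 * n) * cpoly (Phi (2 * n)) (1 / z)"
    by (simp add: cpoly_as_sum sum_distrib_left distrib_left sum.distrib mult_ac)
  also have "\<dots> = cpoly (recip_poly n) z"
    using conjunct1[OF reversal[OF z, of "2 * n"]] by (simp add: recip_poly_def)
  finally show ?thesis .
qed

definition recip_sqnorm where "recip_sqnorm n = circ_inner (recip_poly n) (recip_poly n)"

lemma recip_sqnorm_pos: "recip_sqnorm n > 0"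
proof -
  have "cpoly (recip_poly n) 0 \<noteq> 0" unfolding recip_poly_def by (rule Psi_plus_Phi_nonzero) simp
  hence "recip_poly n \<noteq> 0" by auto
  thus ?thesis unfolding recip_sqnorm_def by (rule circ_inner_self_pos)
qed

text \<open>The cross term is \<open>\<langle>\<Phi>\<^sub>k\<^sub>+\<^sub>1, \<Psi>\<^sub>k\<^sub>+\<^sub>1\<rangle> = -a\<^sub>k \<parallel>\<Phi>\<^sub>k\<^sub>+\<^sub>1\<parallel>\<^sup>2\<close> with \<open>k = 2n + 1\<close>.\<close>
lemma recip_sqnorm_Suc: "recip_sqnorm (Suc n) = 2 * Phi_sqnorm (2 * Suc n) * (1 - verblunsky (2 * n + 1))"
proof -
  define k where "k = 2 * n + 1"
  have k: "2 * Suc n = Suc k" by (simp add: k_def)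
  have "recip_sqnorm (Suc n) = Phi_sqnorm (Suc k) + 2 * circ_inner (Phi (Suc k)) (Psi (Suc k)) + Phi_sqnorm (Suc k)"
    unfolding recip_sqnorm_def recip_poly_def k by (simp add: circ_inner_linear circ_inner_Psi_Psi Phi_sqnorm_def[symmetric]
      circ_inner_commute[of "Psi (Suc k)" "Phi (Suc k)"])
  thus ?thesis unfolding circ_inner_Phi_Psi_Suc k k_def[symmetric] by (simp add: algebra_simps)
qed

lemma recip_sqnorm_ratio_tendsto: "(\<lambda>n. sqrt (recip_sqnorm (Suc n) / recip_sqnorm n)) \<longlonglongrightarrow> 1"
proof -
  obtain l where l: "l > 0" "Phi_sqnorm \<longlonglongrightarrow> l" by (rule Phi_sqnorm_convergent)
  have "(\<lambda>n. 2 * Phi_sqnorm (2 * Suc n) * (1 - verblunsky (2 * n + 1))) \<longlonglongrightarrow> 2 * l * (1 - 0)"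
    by (intro tendsto_intros filterlim_compose[OF l(2)] filterlim_compose[OF verblunsky_tendsto_0]
          filterlim_subseq) (auto simp: strict_mono_def)
  hence 1: "(\<lambda>n. recip_sqnorm (Suc n)) \<longlonglongrightarrow> 2 * l" by (simp add: recip_sqnorm_Suc)
  hence 2: "recip_sqnorm \<longlonglongrightarrow> 2 * l" by (rule LIMSEQ_imp_Suc)
  have "(\<lambda>n. sqrt (recip_sqnorm (Suc n) / recip_sqnorm n)) \<longlonglongrightarrow> sqrt (2 * l / (2 * l))"
    by (intro tendsto_intros 1 2) (use l in auto)
  thus ?thesis using l by simp
qed

text \<open>Dividing the Szego recursion by \<open>\<Psi>\<^sub>n\<close> turns it into the Schur recursion for this quotient, which is
bounded by \<open>1\<close> on the disk.\<close>
definition schur :: "nat \<Rightarrow> complex \<Rightarrow> complex" where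
  "schur n z = cpoly (Phi n) z / cpoly (Psi n) z"

lemma schur_le_1: "cmod z \<le> 1 \<Longrightarrow> cmod (schur n z) \<le> 1"
  using Psi_dominates[of z n] by (simp add: schur_def norm_divide divide_le_eq_1)

lemma schur_denominator:
  assumes "cmod z \<le> 1"
  shows "1 - \<bar>verblunsky n\<bar> \<le> cmod (1 - of_real (verblunsky n) * z * schur n z)" "1 - of_real (verblunsky n) * z * schur n z \<noteq> 0"
proof -
  have "cmod (of_real (verblunsky n) * z * schur n z) \<le> \<bar>verblunsky n\<bar> * 1 * 1"
    unfolding norm_mult using assms schur_le_1[OF assms] by (intro mult_mono) auto
  thus "1 - \<bar>verblunsky n\<bar> \<le> cmod (1 - of_real (verblunsky n) * z * schur n z)"
    using norm_triangle_ineq2[of 1 "of_real (verblunsky n) * z * schur n z"] by simp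
  with verblunsky_less_1[of n] show "1 - of_real (verblunsky n) * z * schur n z \<noteq> 0" by auto
qed

lemma Psi_Suc_schur:
  assumes "cmod z \<le> 1"
  shows "cpoly (Psi (Suc n)) z = cpoly (Psi n) z * (1 - of_real (verblunsky n) * z * schur n z)"
  using Psi_dominates[OF assms, of n]
  by (simp add: Psi_Suc schur_def field_simps del: smult_pCons)

lemma schur_Suc:
  assumes "cmod z \<le> 1"
  shows "schur (Suc n) z = z / (1 - of_real (verblunsky n) * z * schur n z) * schur n z
           + (- of_real (verblunsky n) / (1 - of_real (verblunsky n) * z * schur n z))"
proof -
  define d where "d = 1 - of_real (verblunsky n) * z * schur n z"
  have d: "d \<noteq> 0" using schur_denominator(2)[OF assms] by (simp add: d_def)
  have P: "cpoly (Psi n) z \<noteq> 0" using Psi_dominates[OF assms] by blast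
  have "cpoly (Phi (Suc n)) z = cpoly (Psi n) z * (z * schur n z - of_real (verblunsky n))"
    using P by (simp add: Phi_Suc schur_def field_simps)
  hence "schur (Suc n) z = (z * schur n z - of_real (verblunsky n)) / d"
    unfolding schur_def[of "Suc n"] Psi_Suc_schur[OF assms] d_def[symmetric] using P by simp
  thus ?thesis unfolding d_def[symmetric] using d by (simp add: field_simps)
qed

lemma verblunsky_bound_tendsto: "(\<lambda>n. \<bar>verblunsky n\<bar> / (1 - \<bar>verblunsky n\<bar>)) \<longlonglongrightarrow> 0"
proof -
  have "(\<lambda>n. \<bar>verblunsky n\<bar> / (1 - \<bar>verblunsky n\<bar>)) \<longlonglongrightarrow> \<bar>0\<bar> / (1 - \<bar>0\<bar>)"
    by (intro tendsto_intros verblunsky_tendsto_0) auto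
  thus ?thesis by simp
qed

lemma schur_quotient_bound:
  assumes "cmod z \<le> 1" "cmod c \<le> \<bar>verblunsky n\<bar>"
  shows "cmod (c / (1 - of_real (verblunsky n) * z * schur n z)) \<le> \<bar>verblunsky n\<bar> / (1 - \<bar>verblunsky n\<bar>)"
  unfolding norm_divide using schur_denominator(1)[OF assms(1), of n] assms(2) verblunsky_less_1[of n]
  by (intro frac_le) auto

lemma verblunsky_z_schur_bound:
  assumes "cmod z \<le> 1"
  shows "cmod (of_real (verblunsky n) * z * schur n z) \<le> \<bar>verblunsky n\<bar>"
proof -
  have "cmod (of_real (verblunsky n) * z * schur n z) \<le> \<bar>verblunsky n\<bar> * 1 * 1"
    unfolding norm_mult using assms schur_le_1[OF assms] by (intro mult_mono) auto
  thus ?thesis by simp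
qed

text \<open>The functions in question are the ratios \<open>\<Psi>\<^sub>n / \<Psi>\<^sub>n\<^sub>+\<^sub>1\<close>.\<close>
lemma inverse_denominator_limit:
  "uniform_limit (cball 0 1) (\<lambda>n z. 1 / (1 - of_real (verblunsky n) * z * schur n z)) (\<lambda>_. 1) sequentially"
proof (rule uniform_limit_by_bound[OF _ verblunsky_bound_tendsto])
  fix n and z :: complex assume z: "z \<in> cball 0 1"
  hence "cmod z \<le> 1" by simp
  note d = schur_denominator(2)[OF this, of n]
  have "1 / (1 - of_real (verblunsky n) * z * schur n z) - 1
      = of_real (verblunsky n) * z * schur n z / (1 - of_real (verblunsky n) * z * schur n z)"
    using d by (simp add: field_simps)
  thus "cmod (1 / (1 - of_real (verblunsky n) * z * schur n z) - 1) \<le> \<bar>verblunsky n\<bar> / (1 - \<bar>verblunsky n\<bar>)"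
    using schur_quotient_bound[OF \<open>cmod z \<le> 1\<close> verblunsky_z_schur_bound[OF \<open>cmod z \<le> 1\<close>]] by simp
qed

text \<open>As the coefficients vanish, the Schur recursion approaches \<open>S \<mapsto> z S\<close>, which contracts uniformly for
\<open>\<bar>z\<bar> \<le> r < 1\<close>.\<close>
lemma schur_limit:
  assumes "r < 1"
  shows "uniform_limit (cball 0 r) schur (\<lambda>_. 0) sequentially"
proof -
  have sub: "cball 0 r \<subseteq> cball (0::complex) 1" using assms by auto
  have t: "uniform_limit (cball 0 r) (\<lambda>n z. z * (1 / (1 - of_real (verblunsky n) * z * schur n z))) (\<lambda>z. z * 1) sequentially"
    by (intro uniform_lim_mult uniform_limit_const uniform_limit_on_subset[OF inverse_denominator_limit sub]
          bounded_const_image) auto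
  have v: "uniform_limit (cball 0 r) (\<lambda>n z. - of_real (verblunsky n) / (1 - of_real (verblunsky n) * z * schur n z)) (\<lambda>_. 0) sequentially"
    by (rule uniform_limit_by_bound[OF _ verblunsky_bound_tendsto])
       (use schur_quotient_bound sub in force)
  have "uniform_limit (cball 0 r) schur (\<lambda>z. 0 / (1 - z * 1)) sequentially"
  proof (rule uniform_limit_affine_recursion[OF _ t v _ _ assms])
    fix n and z :: complex assume "z \<in> cball 0 r"
    thus "schur (Suc n) z = z * (1 / (1 - of_real (verblunsky n) * z * schur n z)) * schur n z
            + - of_real (verblunsky n) / (1 - of_real (verblunsky n) * z * schur n z)"
      using schur_Suc[of z n] sub by auto
  next
    fix n show "bounded (schur n ` cball 0 r)"
      unfolding bounded_iff using schur_le_1 sub by (intro exI[of _ 1]) auto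
  qed (auto intro: bounded_const_image)
  thus ?thesis by simp
qed

lemma recip_poly_eq_schur: "cmod z \<le> 1 \<Longrightarrow> cpoly (recip_poly n) z = cpoly (Psi (2 * n)) z * (1 + schur (2 * n) z)"
  using Psi_dominates[of z "2 * n"] by (simp add: recip_poly_def schur_def field_simps)

lemma recip_poly_ratio_limit:
  assumes "r < 1"
  shows "uniform_limit (cball 0 r) (\<lambda>n z. cpoly (recip_poly n) z / cpoly (recip_poly (Suc n)) z) (\<lambda>_. 1) sequentially"
proof -
  define D where "D = (\<lambda>n z. 1 / (1 - complex_of_real (verblunsky n) * z * schur n z))"
  have sub: "cball 0 r \<subseteq> cball (0::complex) 1" using assms by auto
  have D: "uniform_limit (cball 0 r) D (\<lambda>_. 1) sequentially"
    unfolding D_def by (rule uniform_limit_on_subset[OF inverse_denominator_limit sub])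
  note S = schur_limit[OF assms]
  have D2: "uniform_limit (cball 0 r) (\<lambda>n. D (2 * n)) (\<lambda>_. 1) sequentially"
    and D2': "uniform_limit (cball 0 r) (\<lambda>n. D (Suc (2 * n))) (\<lambda>_. 1) sequentially"
    and S2: "uniform_limit (cball 0 r) (\<lambda>n. schur (2 * n)) (\<lambda>_. 0) sequentially"
    and S2': "uniform_limit (cball 0 r) (\<lambda>n. schur (2 * Suc n)) (\<lambda>_. 0) sequentially"
    by (rule filterlim_compose[OF D] filterlim_compose[OF S], rule filterlim_subseq, simp add: strict_mono_def)+
  have "uniform_limit (cball 0 r) (\<lambda>n z. D (2 * n) z * D (Suc (2 * n)) z * ((1 + schur (2 * n) z) / (1 + schur (2 * Suc n) z)))
          (\<lambda>_. 1 * 1 * ((1 + 0) / (1 + 0))) sequentially"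
    by (intro uniform_lim_mult D2 D2' uniform_lim_divide[where b = 1] uniform_limit_add uniform_limit_const S2 S2'
          bounded_const_image) auto
  moreover have "D (2 * n) z * D (Suc (2 * n)) z * ((1 + schur (2 * n) z) / (1 + schur (2 * Suc n) z))
      = cpoly (recip_poly n) z / cpoly (recip_poly (Suc n)) z" if "z \<in> cball 0 r" for n z
  proof -
    have z: "cmod z \<le> 1" using that sub by auto
    define d1 where "d1 = 1 - complex_of_real (verblunsky (2 * n)) * z * schur (2 * n) z"
    define d2 where "d2 = 1 - complex_of_real (verblunsky (Suc (2 * n))) * z * schur (Suc (2 * n)) z"
    have "cpoly (Psi (2 * Suc n)) z = cpoly (Psi (2 * n)) z * d1 * d2"
      unfolding d1_def d2_def using Psi_Suc_schur[OF z, of "2 * n"] Psi_Suc_schur[OF z, of "Suc (2 * n)"] by simp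
    thus ?thesis using Psi_dominates[OF z, of "2 * n"] 
      unfolding recip_poly_eq_schur[OF z] D_def d1_def[symmetric] d2_def[symmetric] by simp
  qed
  ultimately show ?thesis by (subst (asm) uniform_limit_cong') auto
qed

definition szego_poly :: "nat \<Rightarrow> real poly" where "szego_poly n = smult (1 / sqrt (recip_sqnorm n)) (folded_poly n)"

lemma cpoly_szego_poly:
  assumes "z \<noteq> 0"
  shows "cpoly (szego_poly n) ((z + 1 / z) / 2) = cpoly (recip_poly n) z / (z ^ n * of_real (sqrt (recip_sqnorm n)))"
proof -
  have "cpoly (folded_poly n) ((z + 1 / z) / 2) = cpoly (recip_poly n) z / z ^ n"
    using cpoly_folded_poly_joukowski[OF assms, of n] assms by (simp add: field_simps)
  thus ?thesis by (simp add: szego_poly_def field_simps)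
qed

lemma szego_poly_nonzero:
  assumes "z \<noteq> 0" "cmod z < 1"
  shows "cpoly (szego_poly n) ((z + 1 / z) / 2) \<noteq> 0"
  using Psi_plus_Phi_nonzero[OF assms(2), of "2 * n"] assms recip_sqnorm_pos[of n]
  by (simp add: cpoly_szego_poly recip_poly_def)

text \<open>The powers \<open>z\<^sup>-\<^sup>n\<close> in consecutive polynomials leave one factor \<open>z\<close>; the remaining factors tend to \<open>1\<close>.\<close>
lemma szego_poly_ratio_limit:
  assumes "r < 1"
  shows "uniform_limit (cball 0 r - {0})
     (\<lambda>n z. cpoly (szego_poly n) ((z + 1 / z) / 2) / cpoly (szego_poly (Suc n)) ((z + 1 / z) / 2)) (\<lambda>z. z) sequentially"
proof -
  have c: "uniform_limit (cball 0 r) (\<lambda>n (z::complex). complex_of_real (sqrt (recip_sqnorm (Suc n) / recip_sqnorm n))) (\<lambda>_. of_real 1) sequentially"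
    by (rule uniform_limit_of_const) (intro tendsto_of_real recip_sqnorm_ratio_tendsto)
  have "uniform_limit (cball 0 r) (\<lambda>n z. z * (cpoly (recip_poly n) z / cpoly (recip_poly (Suc n)) z) * complex_of_real (sqrt (recip_sqnorm (Suc n) / recip_sqnorm n)))
      (\<lambda>z. z * 1 * of_real 1) sequentially"
    by (intro uniform_lim_mult recip_poly_ratio_limit[OF assms] uniform_limit_const c bounded_const_image) auto
  hence "uniform_limit (cball 0 r - {0}) (\<lambda>n z. z * (cpoly (recip_poly n) z / cpoly (recip_poly (Suc n)) z) * complex_of_real (sqrt (recip_sqnorm (Suc n) / recip_sqnorm n)))
      (\<lambda>z. z * 1 * of_real 1) sequentially" by (rule uniform_limit_on_subset) auto
  thus ?thesis
  proof (subst (asm) uniform_limit_cong')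
    fix n and z :: complex assume "z \<in> cball 0 r - {0}"
    hence z: "z \<noteq> 0" by simp
    have "cpoly (szego_poly n) ((z + 1 / z) / 2) / cpoly (szego_poly (Suc n)) ((z + 1 / z) / 2)
       = z * (cpoly (recip_poly n) z / cpoly (recip_poly (Suc n)) z) * (complex_of_real (sqrt (recip_sqnorm (Suc n))) / of_real (sqrt (recip_sqnorm n)))"
      using z recip_sqnorm_pos[of n] recip_sqnorm_pos[of "Suc n"] unfolding cpoly_szego_poly[OF z] by (simp add: field_simps)
    thus "z * (cpoly (recip_poly n) z / cpoly (recip_poly (Suc n)) z) * complex_of_real (sqrt (recip_sqnorm (Suc n) / recip_sqnorm n))
       = cpoly (szego_poly n) ((z + 1 / z) / 2) / cpoly (szego_poly (Suc n)) ((z + 1 / z) / 2)"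
      by (simp add: real_sqrt_divide)
  qed auto
qed

end

section \<open>Identification of the orthonormal polynomials\<close>

lemma poly_in_graded_basis:
  fixes b :: "nat \<Rightarrow> real poly"
  assumes b: "\<And>k. degree (b k) = k" "\<And>k. b k \<noteq> 0"
  shows "degree s \<le> n \<Longrightarrow> \<exists>c. s = (\<Sum>k\<le>n. smult (c k) (b k))"
proof (induction n arbitrary: s)
  case 0
  obtain x y where "s = [:x:]" "b 0 = [:y:]" using 0 b(1)[of 0] by (metis degree_eq_zeroE le_zero_eq)
  moreover have "y \<noteq> 0" using b(2)[of 0] \<open>b 0 = [:y:]\<close> by auto
  ultimately show ?case by (intro exI[of _ "\<lambda>_. x / y"]) simp
next
  case (Suc n)
  define a where "a = coeff s (Suc n) / lead_coeff (b (Suc n))"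
  have lc: "coeff (b (Suc n)) (Suc n) \<noteq> 0" using b[of "Suc n"] by (metis leading_coeff_0_iff)
  have "degree (s - smult a (b (Suc n))) \<le> Suc n"
    using Suc.prems b(1)[of "Suc n"] by (intro degree_diff_le order_trans[OF degree_smult_le]) auto
  moreover have "coeff (s - smult a (b (Suc n))) (Suc n) = 0"
    using lc b(1)[of "Suc n"] by (simp add: a_def)
  ultimately have "degree (s - smult a (b (Suc n))) \<le> n"
    by (metis coeff_0 degree_0 le_Suc_eq leading_coeff_0_iff zero_le)
  from Suc.IH[OF this] obtain c where c: "s - smult a (b (Suc n)) = (\<Sum>k\<le>n. smult (c k) (b k))" by blast
  have "s = (\<Sum>k\<le>Suc n. smult ((c(Suc n := a)) k) (b k))"
    using c by (simp add: algebra_simps)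
  thus ?case by blast
qed

context szego_weight
begin

text \<open>The integral of \<open>r\<close> over \<open>[-1, 1]\<close> against the weight that corresponds to \<open>f\<close> under \<open>x = cos t\<close>.\<close>
definition weight_integral :: "real poly \<Rightarrow> real" where
  "weight_integral r = (LINT t:{0..pi}|lebesgue. poly r (cos t) * f t)"

lemma weight_integral_integrable: "set_integrable lebesgue {0..pi} (\<lambda>t. poly r (cos t) * f t)"
  by (intro continuous_times_weight_integrable continuous_intros)

lemma weight_integral_add: "weight_integral (r + s) = weight_integral r + weight_integral s"
  unfolding weight_integral_def by (subst set_integral_add(2)[symmetric, OF weight_integral_integrable weight_integral_integrable])
    (simp add: algebra_simps)

lemma weight_integral_smult: "weight_integral (smult a r) = a * weight_integral r"
  unfolding weight_integral_def by (subst set_integral_mult_right[symmetric]) (simp add: algebra_simps)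

lemma weight_integral_sum: "weight_integral (sum F A) = (\<Sum>i\<in>A. weight_integral (F i))"
  by (induction A rule: infinite_finite_induct) (use weight_integral_smult[of 0 0] in \<open>auto simp: weight_integral_add\<close>)

lemma weight_integral_eq_circ_inner:
  assumes "\<And>t. complex_of_real (poly r (cos t)) = cpoly P (cis t) * cnj (cpoly Q (cis t))"
  shows "weight_integral r = circ_inner P Q"
proof -
  have "poly r (cos t) = Re (cpoly P (cis t) * cnj (cpoly Q (cis t)))" for t
    unfolding assms[symmetric] by simp
  thus ?thesis by (simp add: weight_integral_def circ_inner_def)
qed

lemma joukowski_cis: "(cis t + 1 / cis t) / 2 = of_real (cos t)"
  by (simp add: inverse_cis_eq_cnj complex_eq_iff)

lemma poly_folded_poly_cos: "complex_of_real (poly (folded_poly n) (cos t)) = cnj (cis t) ^ n * cpoly (recip_poly n) (cis t)"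
proof -
  have "cis t ^ n * of_real (poly (folded_poly n) (cos t)) = cpoly (recip_poly n) (cis t)"
    using cpoly_folded_poly_joukowski[of "cis t" n] by (simp only: joukowski_cis cpoly_of_real cis_neq_zero not_False_eq_True)
  hence "cnj (cis t) ^ n * cpoly (recip_poly n) (cis t) = (cnj (cis t) * cis t) ^ n * of_real (poly (folded_poly n) (cos t))"
    by (simp add: power_mult_distrib mult_ac)
  thus ?thesis unfolding cnj_cis_mult by simp
qed

lemma poly_cheb_cos: "complex_of_real (poly (cheb k) (cos t)) = (cis t ^ k + cnj (cis t) ^ k) / 2"
  using cpoly_cheb_joukowski[of "cis t" k]
  unfolding joukowski_cis cpoly_of_real by (simp add: inverse_cis_eq_cnj power_one_over[symmetric])

text \<open>Multiplied by \<open>z\<^sup>n\<close>, the Chebyshev polynomial of degree \<open>k\<close> becomes \<open>(z\<^sup>n\<^sup>+\<^sup>k + z\<^sup>n\<^sup>-\<^sup>k)/2\<close>. Both exponents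
lie strictly between \<open>0\<close> and \<open>2n\<close>, where \<open>\<Phi>\<^sub>2\<^sub>n\<close> and \<open>\<Psi>\<^sub>2\<^sub>n\<close> are orthogonal to all powers.\<close>
lemma weight_integral_folded_cheb:
  assumes "k < n" shows "weight_integral (folded_poly n * cheb k) = 0"
proof -
  have "weight_integral (folded_poly n * cheb k) = circ_inner (recip_poly n) (smult (1/2) (monom 1 (n + k) + monom 1 (n - k)))"
  proof (rule weight_integral_eq_circ_inner)
    fix t
    have "cnj (cis t) ^ n * cis t ^ k = cnj (cis t) ^ (n - k) * (cnj (cis t) * cis t) ^ k"
      using assms by (simp add: power_mult_distrib flip: power_add)
    hence *: "cnj (cis t) ^ n * cis t ^ k = cnj (cis t) ^ (n - k)" unfolding cnj_cis_mult by simp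
    have "complex_of_real (poly (folded_poly n * cheb k) (cos t))
       = cpoly (recip_poly n) (cis t) * ((cnj (cis t) ^ n * cis t ^ k + cnj (cis t) ^ n * cnj (cis t) ^ k) / 2)"
      unfolding poly_mult of_real_mult poly_folded_poly_cos poly_cheb_cos by (simp add: algebra_simps)
    also have "\<dots> = cpoly (recip_poly n) (cis t) * cnj (cpoly (smult (1/2) (monom 1 (n + k) + monom 1 (n - k))) (cis t))"
      unfolding * by (simp add: power_add del: cis_cnj)
    finally show "complex_of_real (poly (folded_poly n * cheb k) (cos t))
       = cpoly (recip_poly n) (cis t) * cnj (cpoly (smult (1/2) (monom 1 (n + k) + monom 1 (n - k))) (cis t))" .
  qed
  also have "\<dots> = 0" using assms by (simp add: recip_poly_def circ_inner_linear Phi_orthogonal Psi_orthogonal)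
  finally show ?thesis .
qed

lemma weight_integral_folded_square: "weight_integral (folded_poly n * folded_poly n) = recip_sqnorm n"
  unfolding recip_sqnorm_def
proof (rule weight_integral_eq_circ_inner)
  fix t
  define x where "x = complex_of_real (poly (folded_poly n) (cos t))"
  have "complex_of_real (poly (folded_poly n * folded_poly n) (cos t)) = x * cnj x" by (simp add: x_def)
  also have "\<dots> = (cnj (cis t) * cis t) ^ n * (cpoly (recip_poly n) (cis t) * cnj (cpoly (recip_poly n) (cis t)))"
    unfolding x_def poly_folded_poly_cos by (simp add: power_mult_distrib mult_ac del: cis_cnj)
  finally show "complex_of_real (poly (folded_poly n * folded_poly n) (cos t)) = cpoly (recip_poly n) (cis t) * cnj (cpoly (recip_poly n) (cis t))"
    unfolding cnj_cis_mult by simp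
qed

lemma weight_integral_folded_orthogonal:
  assumes "degree s < n" shows "weight_integral (folded_poly n * s) = 0"
proof -
  have "cheb k \<noteq> 0" for k using cheb_degree[of k] by auto
  then obtain c where c: "s = (\<Sum>k\<le>degree s. smult (c k) (cheb k))"
    using poly_in_graded_basis[of cheb s "degree s"] by auto
  have "weight_integral (folded_poly n * s) = weight_integral (\<Sum>k\<le>degree s. smult (c k) (folded_poly n * cheb k))"
    by (subst c) (simp add: sum_distrib_left)
  also have "\<dots> = 0" unfolding weight_integral_sum weight_integral_smult using assms by (intro sum.neutral) (auto simp: weight_integral_folded_cheb)
  finally show ?thesis .
qed

text \<open>In the basis of the \<open>p k\<close> only the top coefficient of the folded polynomial survives, by orthogonality
to lower degrees; its square is the squared norm.\<close>
lemma orthonormal_poly_eq_szego_poly: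
  assumes deg: "\<And>k. degree (p k) = k"
    and on: "\<And>k l. weight_integral (p k * p l) = (if k = l then 1 else 0)"
  shows "p n = szego_poly n \<or> p n = - szego_poly n"
proof -
  have "p k \<noteq> 0" for k using on[of k k] weight_integral_smult[of 0 0] by auto
  then obtain c where c: "folded_poly n = (\<Sum>k\<le>n. smult (c k) (p k))"
    using poly_in_graded_basis[of p "folded_poly n" n] deg degree_folded_poly by auto
  have Lqp: "weight_integral (folded_poly n * p k) = c k" if "k \<le> n" for k
  proof -
    have "weight_integral (folded_poly n * p k) = weight_integral (\<Sum>j\<le>n. smult (c j) (p j * p k))"
      by (subst c) (simp add: sum_distrib_right)
    also have "\<dots> = (\<Sum>j\<le>n. if j = k then c j else 0)"
      unfolding weight_integral_sum weight_integral_smult on by (intro sum.cong) auto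
    also have "\<dots> = c k" using that by simp
    finally show ?thesis .
  qed
  have "c k = 0" if "k < n" for k
    using Lqp[of k] that weight_integral_folded_orthogonal[of "p k" n] deg by simp
  hence "folded_poly n = smult (c n) (p n)"
    by (subst c, subst sum.remove[of _ n]) (auto intro!: sum.neutral)
  moreover from this have "weight_integral (folded_poly n * folded_poly n) = (c n)\<^sup>2"
    using on[of n n] by (simp add: weight_integral_smult power2_eq_square)
  hence cn: "(c n)\<^sup>2 = recip_sqnorm n" by (simp add: weight_integral_folded_square)
  have "c n \<noteq> 0" using cn recip_sqnorm_pos[of n] by auto
  have "sqrt (recip_sqnorm n) = \<bar>c n\<bar>" using cn by (metis real_sqrt_abs)
  ultimately have "szego_poly n = smult (c n / \<bar>c n\<bar>) (p n)" by (simp add: szego_poly_def)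
  thus ?thesis using \<open>c n \<noteq> 0\<close> by (cases "c n > 0") (auto simp: abs_if)
qed

end

section \<open>Convergence of the intensity\<close>

lemma cpoly_uminus: "cpoly (- P) z = - cpoly P z"
  using cpoly_diff[of 0 P z] by simp

text \<open>Each summand of each kernel is quadratic in \<open>p j\<close>.\<close>
lemma intensity_sign_invariant:
  assumes "\<And>j. p j = r j \<or> p j = - r j"
  shows "intensity p = intensity r"
proof -
  have "cpoly (p j) z * cnj (cpoly (p j) y) = cpoly (r j) z * cnj (cpoly (r j) y)"
    "cpoly (p j) z * cnj (cpoly (pderiv (p j)) y) = cpoly (r j) z * cnj (cpoly (pderiv (r j)) y)"
    "cpoly (pderiv (p j)) z * cnj (cpoly (pderiv (p j)) y) = cpoly (pderiv (r j)) z * cnj (cpoly (pderiv (r j)) y)"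
    for j z y using assms[of j] by (auto simp: cpoly_uminus pderiv_minus)
  thus ?thesis by (intro ext) (simp add: intensity_def kernel_def kernel01_def kernel11_def)
qed

lemma integral_cos_substitution:
  fixes h :: "real \<Rightarrow> real"
  assumes "set_integrable lebesgue {0..pi} (\<lambda>t. h (cos t) * \<bar>sin t\<bar>)"
  shows "(LINT x:{-1..1}|lebesgue. h x) = (LINT t:{0..pi}|lebesgue. h (cos t) * \<bar>sin t\<bar>)"
proof -
  have img: "cos ` {0..pi} = {-1..1}"
  proof
    show "{-1..1} \<subseteq> cos ` {0..pi}"
    proof
      fix x :: real assume "x \<in> {-1..1}"
      thus "x \<in> cos ` {0..pi}"
        by (intro image_eqI[of _ _ "arccos x"]) (auto simp: arccos_lbound arccos_ubound)
    qed
  qed auto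
  have i: "(\<lambda>t. \<bar>- sin t\<bar> * h (cos t)) absolutely_integrable_on {0..pi}"
    using assms by (simp add: mult.commute)
  have "h absolutely_integrable_on cos ` {0..pi} \<and>
     integral (cos ` {0..pi}) h = integral {0..pi} (\<lambda>t. \<bar>- sin t\<bar> * h (cos t))"
    by (subst has_absolute_integral_change_of_variables_1'[symmetric, where g' = "\<lambda>t. - sin t"])
       (use i cos_inj_pi in \<open>auto intro!: derivative_eq_intros inj_onI\<close>)
  thus ?thesis unfolding img using assms
    by (simp add: set_lebesgue_integral_eq_integral mult.commute)
qed

lemma szego_class_imp_szego_weight:
  assumes "szego_class f" shows "szego_weight f"
proof
  have sub: "{0..pi} \<subseteq> {-pi..pi}" by auto
  show "set_integrable lebesgue {0..pi} f"
    using assms unfolding szego_class_def by (intro set_integrable_subset[OF _ _ sub]) auto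
  show "0 \<le> f t" if "t \<in> {0..pi}" for t
    using assms that unfolding szego_class_def by (auto dest!: bspec[of _ _ t])
  show "AE t in lebesgue. t \<in> {0..pi} \<longrightarrow> 0 < f t"
  proof -
    have "AE t in lebesgue. t \<in> {-pi..pi} \<longrightarrow> 0 < f t" using assms by (simp add: szego_class_def)
    thus ?thesis by eventually_elim auto
  qed
  have "set_borel_measurable lebesgue {-pi..pi} (\<lambda>t. ln (f t))"
  proof -
    have "(\<lambda>t. indicator {-pi..pi} t *\<^sub>R f t) \<in> borel_measurable lebesgue"
      using assms by (simp add: szego_class_def set_borel_measurable_def)
    hence "(\<lambda>t. ln (indicator {-pi..pi} t *\<^sub>R f t)) \<in> borel_measurable lebesgue"
      by (rule borel_measurable_ln)
    \<comment> \<open>Outside the interval both sides vanish, by the convention \<open>ln 0 = 0\<close>.\<close>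
    moreover have "(\<lambda>t. ln (indicator {-pi..pi} t *\<^sub>R f t)) = (\<lambda>t. indicator {-pi..pi} t *\<^sub>R ln (f t))"
      by (auto simp: fun_eq_iff indicator_def)
    ultimately show ?thesis by (simp add: set_borel_measurable_def)
  qed
  moreover have "set_integrable lebesgue {-pi..pi} (\<lambda>t. \<bar>ln (f t)\<bar>)"
    using assms by (simp add: szego_class_def)
  ultimately have "set_integrable lebesgue {-pi..pi} (\<lambda>t. ln (f t))"
    by (simp add: set_integrable_abs_iff)
  thus "set_integrable lebesgue {0..pi} (\<lambda>t. ln (f t))"
    by (rule set_integrable_subset[OF _ _ sub]) auto
qed

context szego_weight
begin

theorem intensity_szego_poly_limit:
  assumes K: "compact K" "K \<subseteq> - closed_segment (-1) 1"
  shows "uniform_limit K (intensity szego_poly) hyp_density sequentially"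
  unfolding hyp_density_def[abs_def]
proof (rule intensity_limit_of_ratio[OF open_off_segment zeta_holomorphic _ _ _ K])
  show "cmod (zeta z) < 1" if "z \<in> - closed_segment (-1) 1" for z
    using zeta_props(3) that by auto
  show "cpoly (szego_poly n) z \<noteq> 0" if "z \<in> - closed_segment (-1) 1" for n z
  proof -
    have z: "z \<notin> closed_segment (-1) 1" using that by simp
    have "cpoly (szego_poly n) ((zeta z + 1 / zeta z) / 2) \<noteq> 0"
      using zeta_props(2,3)[OF z] by (rule szego_poly_nonzero)
    thus ?thesis unfolding zeta_props(5)[OF z, symmetric] .
  qed
  fix K :: "complex set"
  assume K: "compact K" "K \<subseteq> - closed_segment (-1) 1"
  show "uniform_limit K (\<lambda>n z. cpoly (szego_poly n) z / cpoly (szego_poly (Suc n)) z) zeta sequentially"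
  proof (cases "K = {}")
    case False
    have "continuous_on K (\<lambda>z. cmod (zeta z))"
      using holomorphic_on_imp_continuous_on[OF zeta_holomorphic] K(2)
      by (intro continuous_intros) (rule continuous_on_subset)
    then obtain z0 where z0: "z0 \<in> K" "\<And>z. z \<in> K \<Longrightarrow> cmod (zeta z) \<le> cmod (zeta z0)"
      using continuous_attains_sup[OF K(1) False] by blast
    have r: "cmod (zeta z0) < 1" using zeta_props(3)[of z0] z0(1) K(2) by auto
    have "zeta \<in> K \<rightarrow> cball 0 (cmod (zeta z0)) - {0}"
      using z0(2) zeta_props(2) K(2) by auto
    from uniform_limit_compose'[OF szego_poly_ratio_limit[OF r] this]
    have lim: "uniform_limit K (\<lambda>n z. cpoly (szego_poly n) ((zeta z + 1 / zeta z) / 2) /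
        cpoly (szego_poly (Suc n)) ((zeta z + 1 / zeta z) / 2)) zeta sequentially" .
    have "(zeta z + 1 / zeta z) / 2 = z" if "z \<in> K" for z
      using zeta_props(5)[of z] K(2) that by (metis ComplD subsetD)
    thus ?thesis using lim
      by (subst (asm) uniform_limit_cong'[where g = "\<lambda>n z. cpoly (szego_poly n) z / cpoly (szego_poly (Suc n)) z"
            and i = zeta]) simp_all
  qed simp
qed

end

theorem theorem3:
  fixes w :: "real \<Rightarrow> real"
    and p :: "nat \<Rightarrow> real poly"
    and M :: "'a measure"
    and \<alpha> \<beta> :: "nat \<Rightarrow> 'a \<Rightarrow> real"
    and \<eta> :: "nat \<Rightarrow> 'a \<Rightarrow> complex"
    and P :: "nat \<Rightarrow> 'a \<Rightarrow> complex \<Rightarrow> complex"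
  assumes "weight_function w"
    and "szego_class (\<lambda>\<theta>. w (cos \<theta>) * \<bar>sin \<theta>\<bar>)"
    and "orthonormal_polys w p"
    and "prob_space M"
    and "prob_space.indep_vars M (\<lambda>_. borel) (case_sum \<alpha> \<beta>) UNIV"
    and "\<And>j. distributed M lborel (\<alpha> j) std_normal_density"
    and "\<And>j. distributed M lborel (\<beta> j) std_normal_density"
    and "\<And>j \<omega>. \<eta> j \<omega> = Complex (\<alpha> j \<omega>) (\<beta> j \<omega>)"
    and "\<And>n \<omega> z. P n \<omega> z = (\<Sum>j\<le>n. \<eta> j \<omega> * cpoly (p j) z)"
  shows "continuous_on (- closed_segment (-1) 1) limit_intensity \<and>
         (\<forall>z. z \<notin> closed_segment (-1) 1 \<longrightarrow>
            (\<lambda>n. intensity p n z) \<longlonglongrightarrow> limit_intensity z) \<and>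
         (\<forall>K. compact K \<and> K \<subseteq> - closed_segment (-1) 1 \<longrightarrow>
            uniform_limit K (intensity p) limit_intensity sequentially)"
proof -
  interpret szego_weight "\<lambda>\<theta>. w (cos \<theta>) * \<bar>sin \<theta>\<bar>"
    using assms(2) by (rule szego_class_imp_szego_weight)
  have "weight_integral (p k * p l) = (if k = l then 1 else 0)" for k l
  proof -
    have "(LINT x:{-1..1}|lebesgue. poly (p k * p l) x * w x) = weight_integral (p k * p l)"
      unfolding weight_integral_def using weight_integral_integrable[of "p k * p l"]
      by (subst integral_cos_substitution) (simp_all add: mult.assoc)
    thus ?thesis using assms(3) by (simp add: orthonormal_polys_def)
  qed
  hence "p j = szego_poly j \<or> p j = - szego_poly j" for j
    using assms(3) by (intro orthonormal_poly_eq_szego_poly) (auto simp: orthonormal_polys_def)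
  hence int: "intensity p = intensity szego_poly" by (rule intensity_sign_invariant)
  have unif: "uniform_limit K (intensity p) limit_intensity sequentially"
    if K: "compact K" "K \<subseteq> - closed_segment (-1) 1" for K
    using intensity_szego_poly_limit[OF K] unfolding int
    by (subst (asm) uniform_limit_cong') (use K limit_intensity_eq in auto)
  have "(\<lambda>n. intensity p n z) \<longlonglongrightarrow> limit_intensity z" if "z \<notin> closed_segment (-1) 1" for z
    using tendsto_uniform_limitI[OF unif[of "{z}"]] that by auto
  moreover have "continuous_on (- closed_segment (-1) 1) limit_intensity"
    using hyp_density_continuous_on
    by (subst continuous_on_cong[OF refl, of _ _ hyp_density]) (auto simp: limit_intensity_eq)
  ultimately show ?thesis using unif by blast
qed

end
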